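(* Let $R$ be a commutative ring and let $n\ge 3$. Then the matrix ring ${\rm M}_n(R)$ is a GWNC ring if, and only if, ${\rm M}_n(R)$ is a nil-clean ring.
   Context: All rings are associative with identity. For a ring $S$, $U(S)$, ${\rm Nil}(S)$, ${\rm Id}(S)$ denote the units, nilpotent elements and idempotents. A ring $S$ is GWNC (generalized weakly nil-clean) if every non-unit $a\in S\setminus U(S)$ can be written as $a=q+e$ or $a=q-e$ with $q\in{\rm Nil}(S)$ and $e\in{\rm Id}(S)$. A ring $S$ is nil-clean if every element is a sum of an idempotent and a nilpotent. *)

theory Defs
  imports "HOL-Algebra.Ring" "Jordan_Normal_Form.Matrix"
begin

definition nilpotent_elems :: "('a, 'b) ring_scheme \<Rightarrow> 'a set" where
  "nilpotent_elems R = {q \<in> carrier R. \<exists>k::nat. q [^]\<^bsub>R\<^esub> k = \<zero>\<^bsub>R\<^esub>}"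

definition idempotent_elems :: "('a, 'b) ring_scheme \<Rightarrow> 'a set" where
  "idempotent_elems R = {e \<in> carrier R. e \<otimes>\<^bsub>R\<^esub> e = e}"

definition GWNC :: "('a, 'b) ring_scheme \<Rightarrow> bool" where
  "GWNC R \<longleftrightarrow> (\<forall>a \<in> carrier R - Units R.
      \<exists>q \<in> nilpotent_elems R. \<exists>e \<in> idempotent_elems R.
        a = q \<oplus>\<^bsub>R\<^esub> e \<or> a = q \<ominus>\<^bsub>R\<^esub> e)"

definition nil_clean :: "('a, 'b) ring_scheme \<Rightarrow> bool" where
  "nil_clean R \<longleftrightarrow> (\<forall>a \<in> carrier R.
      \<exists>q \<in> nilpotent_elems R. \<exists>e \<in> idempotent_elems R. a = e \<oplus>\<^bsub>R\<^esub> q)"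

end

theory Submission
  imports Defs "HOL-Library.Z2" "HOL-Library.Numeral_Type" "HOL-Library.Function_Algebras"
begin

text \<open>
  Write \<open>N\<close> for the nilradical of \<open>R\<close>. If the matrix ring is GWNC and \<open>n \<ge> 3\<close>, then every scalar \<open>c\<close>
  satisfies \<open>c (c - s) \<in> N\<close> for a sign \<open>s\<close>: decompose \<open>diag(c, c, 0, c, \<dots>) = q + s e\<close> and look at the
  vectors \<open>v\<close> such that \<open>v\<close> and \<open>e v\<close> have zero entry at the zero row; they span an \<open>e\<close>-invariant module on
  which \<open>q\<close> acts as \<open>c - s e\<close>. So every residue field of \<open>R\<close> at a prime has two or three elements. Three
  is excluded by \<open>diag(1, -1, 0, \<dots>) = q + s e\<close>: the idempotent \<open>e\<close> would have rank at most 2 and trace 0,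
  hence be 0. Therefore \<open>N\<close> is the intersection of the kernels of the homomorphisms from \<open>R\<close> to the field
  with two elements.

  Over the field with two elements every matrix is an idempotent plus a nilpotent: split off a
  cyclic space of functionals \<open>f, f T, f T\<^sup>2, \<dots>\<close>, give an explicit decomposition of the companion
  matrix, and induct on the complementary block. These decompositions, one for each 0-1-matrix, are
  glued over \<open>R\<close> modulo \<open>N\<close>, and the resulting idempotent is lifted.
\<close>

section \<open>Matrices over the field with two elements\<close>

text \<open>
  The coefficients \<open>M\<close> describe an operator on the space spanned by \<open>f 0, \<dots>, f (m - 1)\<close>, on which the
  functional \<open>f i\<close> is shifted to \<open>f (Suc i)\<close>. If \<open>c (m - 1) = 1\<close>, the idempotent is the last row of the
  companion matrix. If \<open>c (m - 1) = 0\<close> and \<open>m \<ge> 3\<close>, it has rank 2; it was found in the basis in which the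
  companion matrix has diagonal \<open>(0, \<dots>, 0, 1, 0, 1)\<close>.
\<close>

lemma companion_split:
  fixes f :: "nat \<Rightarrow> 'x \<Rightarrow> 'b::field" and c :: "nat \<Rightarrow> 'b"
  assumes two_elems: "\<And>b::'b. b = 0 \<or> b = 1"
    and rec: "\<And>x. f m x = (\<Sum>i<m. c i * f i x)"
  shows "\<exists>M::nat \<Rightarrow> nat \<Rightarrow> 'b.
    (\<forall>E. (\<forall>i<m. \<forall>x. f i (E x) = (\<Sum>j<m. M i j * f j x)) \<longrightarrow>
         (\<forall>i<m. \<forall>x. (\<Sum>j<m. M i j * f j (E x)) = (\<Sum>j<m. M i j * f j x))) \<and>
    (\<forall>Q. (\<forall>i<m. \<forall>x. f i (Q x) = f (Suc i) x - (\<Sum>j<m. M i j * f j x)) \<longrightarrow>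
         (\<exists>k. \<forall>i<m. \<forall>x. f i ((Q ^^ k) x) = 0))"
    (is "\<exists>M. ?idem M \<and> ?nil M")
proof -
  have two: "b + b = 0" for b :: 'b
    using two_elems[of b] two_elems[of "1 + 1"] by (metis add.right_neutral add_left_imp_eq zero_neq_one)
  then have two0: "(2::'b) = 0"
    by (metis one_add_one)
  have minus: "b - d = b + d" for b d :: 'b
    using two[of d] by (metis add_diff_cancel_right' add.right_neutral add.assoc diff_0_right)
  \<comment> \<open>Over this field the trace of an idempotent is its rank modulo 2, a nilpotent
    matrix has trace 0 and the companion matrix has trace \<open>c (m - 1)\<close>. So the
    idempotent needs odd rank if this is 1 and even rank if it is 0; for \<open>m < 3\<close> the
    latter is met by 0 or the identity.\<close>
  consider "m = 0" | "m \<ge> 1" "c (m - 1) = 1" | "m = 1" "c 0 = 0"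
    | "m = 2" "c 1 = 0" "c 0 = 0" | "m = 2" "c 1 = 0" "c 0 = 1" | "m \<ge> 3" "c (m - 1) = 0"
  proof -
    have "c i = 0 \<or> c i = 1" for i by (rule two_elems)
    moreover have "m = 0 \<or> m = 1 \<or> m = 2 \<or> m \<ge> 3" by linarith
    ultimately show ?thesis using that by fastforce
  qed
  then show ?thesis
  proof cases
    case 1
    then show ?thesis by auto
  next
    case 2
    define m' where "m' = m - 1"
    have m: "Suc m' = m" "m' < m" "c m' = 1" using 2 by (simp_all add: m'_def)
    define M where "M i j = (if i = m' then c j else 0)" for i j
    have g: "(\<Sum>j<m. M i j * h j) = (if i = m' then \<Sum>j<m. c j * h j else 0)"
      for i and h :: "nat \<Rightarrow> 'b"
      by (simp add: M_def)
    have "?idem M"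
    proof (intro allI impI)
      fix E i x
      assume E: "\<forall>i<m. \<forall>x. f i (E x) = (\<Sum>j<m. M i j * f j x)" and i: "i < m"
      have "(\<Sum>j<m. c j * f j (E x)) = (\<Sum>j<m. if j = m' then \<Sum>j<m. c j * f j x else 0)"
        using E m by (intro sum.cong) (simp_all add: g)
      also have "\<dots> = (\<Sum>j<m. c j * f j x)"
        using m by simp
      finally show "(\<Sum>j<m. M i j * f j (E x)) = (\<Sum>j<m. M i j * f j x)"
        by (simp only: g)
    qed
    moreover have "?nil M"
    proof (intro allI impI)
      fix Q assume Q: "\<forall>i<m. \<forall>x. f i (Q x) = f (Suc i) x - (\<Sum>j<m. M i j * f j x)"
      have last: "f m' (Q x) = 0" for x
        using Q rec[of x] m by (simp add: g)
      \<comment> \<open>With the last row removed, \<open>Q\<close> merely shifts the functionals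
        and sends \<open>f m'\<close> to 0; hence \<open>f (m' - i)\<close> survives at most
        \<open>i\<close> steps.\<close>
      have "f (m' - i) ((Q ^^ Suc i) x) = 0" if "i \<le> m'" for i x
        using that
      proof (induction i)
        case 0
        show ?case using last by simp
      next
        case (Suc i)
        then have "m' - Suc i < m" "m' - Suc i \<noteq> m'" "Suc (m' - Suc i) = m' - i"
          using m(1) by auto
        then have "f (m' - Suc i) (Q ((Q ^^ Suc i) x)) = f (m' - i) ((Q ^^ Suc i) x)"
          using Q by (simp add: g del: funpow.simps)
        with Suc show ?case by simp
      qed
      then have *: "f i ((Q ^^ (Suc (m' - i))) x) = 0" if "i < m" for i x
        using that[folded m(1)] by (metis diff_diff_cancel diff_le_self less_Suc_eq_le)
      have "f i ((Q ^^ m) x) = 0" if "i < m" for i x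
      proof -
        have "m = Suc (m' - i) + i" using that m by simp
        then have "(Q ^^ m) x = (Q ^^ (Suc (m' - i))) ((Q ^^ i) x)"
          by (metis comp_apply funpow_add)
        with * that show ?thesis by simp
      qed
      then show "\<exists>k. \<forall>i<m. \<forall>x. f i ((Q ^^ k) x) = 0" by blast
    qed
    ultimately show ?thesis by blast
  next
    case 3
    then show ?thesis
      using rec by (intro exI[of _ "\<lambda>i j. 0"]) (auto intro!: exI[of _ 1])
  next
    case 4
    have r: "f (Suc (Suc 0)) x = 0" for x
      using rec[of x] 4 by (simp add: numeral_2_eq_2)
    have "\<exists>k. \<forall>i<m. \<forall>x. f i ((Q ^^ k) x) = 0"
      if "\<forall>i<m. \<forall>x. f i (Q x) = f (Suc i) x" for Q
      using that r 4 by (intro exI[of _ 2]) (auto simp: numeral_2_eq_2 less_Suc_eq)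
    then show ?thesis
      by (intro exI[of _ "\<lambda>i j. 0"]) simp
  next
    case 5
    have r: "f (Suc (Suc 0)) x = f 0 x" for x
      using rec[of x] 5 by (simp add: numeral_2_eq_2)
    \<comment> \<open>The companion matrix swaps \<open>f 0\<close> and \<open>f 1\<close>; minus
      the identity, this involution squares to 0 in characteristic 2.\<close>
    have "\<exists>k. \<forall>i<m. \<forall>x. f i ((Q ^^ k) x) = 0"
      if "\<forall>i<m. \<forall>x. f i (Q x) = f (Suc i) x - f i x" for Q
      using that r 5 by (intro exI[of _ 2]) (auto simp: numeral_2_eq_2 less_Suc_eq minus add_ac two two0)
    then show ?thesis
      by (intro exI[of _ "\<lambda>i j. of_bool (i = j)"]) (auto simp: 5 numeral_2_eq_2 less_Suc_eq)
  next
    case 6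
    define r where "r = m - 3"
    have m: "Suc (Suc (Suc r)) = m" "r < m" "Suc r < m" "Suc (Suc r) < m" using 6 r_def by simp_all
    \<comment> \<open>Forced by idempotency: applying \<open>M\<close> twice in row
      \<open>Suc (Suc r)\<close> leaves the surplus \<open>c r + c (Suc r) + l + 1\<close> times
      \<open>f (Suc r)\<close>.\<close>
    define l where "l = c r + c (Suc r) + 1"
    define M where "M i j = (if i = r \<or> i = Suc r then of_bool (j = Suc r)
      else if i = Suc (Suc r) then c j + of_bool (j = r) * l + of_bool (j = Suc r) + of_bool (j = Suc (Suc r))
      else 0)" for i j
    have g: "(\<Sum>j<m. M i j * h j) = (if i = r \<or> i = Suc r then h (Suc r)
      else if i = Suc (Suc r) then (\<Sum>j<m. c j * h j) + l * h r + h (Suc r) + h (Suc (Suc r)) else 0)"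
      for i and h :: "nat \<Rightarrow> 'b"
    proof -
      have "(\<Sum>j<m. of_bool (j = k) * h j) = h k" "(\<Sum>j<m. of_bool (j = k) * l * h j) = l * h k"
        if "k < m" for k
        using that by (simp_all add: of_bool_def if_distrib[of "\<lambda>b. b * _"] cong: if_cong)
      note this[of r] this[of "Suc r"] this[of "Suc (Suc r)"]
      then show ?thesis
        by (simp only: M_def distrib_right sum.distrib if_distrib[of "\<lambda>b. b * _"] split: if_split)
          (simp add: m sum.distrib)
    qed
    have cl: "c (Suc (Suc r)) = 0" using 6 by (simp flip: m(1))
    have "?idem M"
    proof (intro allI impI)
      fix E i x
      assume E: "\<forall>i<m. \<forall>x. f i (E x) = (\<Sum>j<m. M i j * f j x)" and i: "i < m"
      have e0: "f j (E x) = 0" if "j < r" for j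
        using E[rule_format, of j x] less_trans[OF that m(2)] that by (simp add: g)
      have e1: "f r (E x) = f (Suc r) x" "f (Suc r) (E x) = f (Suc r) x"
        using E by (simp_all add: g m)
      have "(\<Sum>j<m. c j * f j (E x)) = (c r + c (Suc r)) * f (Suc r) x"
        using e0 by (simp add: m(1)[symmetric] e1 cl distrib_right)
      then show "(\<Sum>j<m. M i j * f j (E x)) = (\<Sum>j<m. M i j * f j x)"
        using E m by (simp add: g e1 l_def distrib_right add_ac two two0)
    qed
    moreover have "?nil M"
    proof (intro allI impI)
      fix Q assume "\<forall>i<m. \<forall>x. f i (Q x) = f (Suc i) x - (\<Sum>j<m. M i j * f j x)"
      then have Q: "f i (Q x) = f (Suc i) x - (if i = r \<or> i = Suc r then f (Suc r) x
        else if i = Suc (Suc r) then (\<Sum>j<m. c j * f j x) + l * f r x + f (Suc r) x + f (Suc (Suc r)) x else 0)"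
        if "i < m" for i x
        using that g by simp
      have q0: "f i (Q x) = f (Suc i) x" if "i < r" for i x
        using Q[of i x] less_trans[OF that m(2)] that by simp
      have q1: "f r (Q x) = 0" "f (Suc r) (Q x) = f (Suc (Suc r)) x + f (Suc r) x" for x
        using Q[of r x] Q[of "Suc r" x] m by (simp_all add: minus)
      have q2: "f (Suc (Suc r)) (Q x) = l * f r x + f (Suc r) x + f (Suc (Suc r)) x" for x
        using Q[of "Suc (Suc r)" x] rec[of x] m by (simp add: minus add_ac two two0)
      have low: "f (r - i) ((Q ^^ Suc i) x) = 0" if "i \<le> r" for i x
        using that
      proof (induction i)
        case 0
        show ?case using q1 by simp
      next
        case (Suc i)
        then have "f (r - Suc i) (Q ((Q ^^ Suc i) x)) = f (r - i) ((Q ^^ Suc i) x)"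
          using q0[of "r - Suc i"] by (simp add: Suc_diff_Suc)
        with Suc show ?case by simp
      qed
      \<comment> \<open>For \<open>i \<le> r\<close> the shift ends in 0 after
        \<open>Suc (r - i)\<close> steps. On the last two functionals \<open>Q\<close> is the
        all-ones block, whose square is 0, up to a multiple of \<open>f r\<close> that a third step
        kills. The exponent \<open>m + 3\<close> covers both.\<close>
      have "f i ((Q ^^ (m + 3)) x) = 0" if "i < m" for i x
      proof (cases "i \<le> r")
        case True
        define j where "j = r - i"
        have "m + 3 = Suc j + (i + 5)" "r - j = i" "j \<le> r" using True m j_def by simp_all
        then show ?thesis
          using low[of j "(Q ^^ (i + 5)) x"] by (simp only: funpow_add comp_apply)
      next
        case False
        have "Q (Q (Q y)) = (Q ^^ 3) y" for y
          by (simp add: numeral_3_eq_3)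
        moreover have "(Q ^^ (m + 3)) x = (Q ^^ 3) ((Q ^^ m) x)"
          by (simp add: add.commute[of m] funpow_add del: funpow.simps)
        moreover have "i = Suc r \<or> i = Suc (Suc r)"
          using False that m by linarith
        moreover have "f r (Q y) = 0" "f (Suc r) (Q (Q (Q y))) = 0" "f (Suc (Suc r)) (Q (Q (Q y))) = 0" for y
          by (simp_all add: q1 q2 algebra_simps two two0)
        ultimately show ?thesis by metis
      qed
      then show "\<exists>k. \<forall>i<m. \<forall>x. f i ((Q ^^ k) x) = 0" by blast
    qed
    ultimately show ?thesis by blast
  qed
qed

text \<open>Subspaces are encoded as ranges of additive idempotents \<open>p\<close>, and operators
  on them as maps \<open>T\<close> with \<open>p (T x) = T x\<close> and
  \<open>T (p x) = T x\<close>, so that an induction on dimension stays within one type. As the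
  scalars are 0 and 1, additive maps are linear. \<open>separating\<close> supplies the functional
  that starts a cyclic space.\<close>

locale two_element_space = vector_space scale
  for scale :: "'b::field \<Rightarrow> 'v::ab_group_add \<Rightarrow> 'v" (infixr \<open>*s\<close> 75) +
  assumes two_elems: "b = 0 \<or> b = (1::'b)"
    and separating: "x \<noteq> 0 \<Longrightarrow> \<exists>f::'v \<Rightarrow> 'b. additive f \<and> f x \<noteq> 0"
begin

lemma functional_scale:
  fixes f :: "'v \<Rightarrow> 'b"
  assumes "additive f"
  shows "f (b *s x) = b * f x"
  using two_elems[of b] additive.zero[OF assms] by auto

text \<open>A Gram-Schmidt step: \<open>r x\<close> has lost the components along the vectors found
  so far. If \<open>f m\<close> vanished on every \<open>r x\<close>, it would be a combination of
  the earlier functionals; so some \<open>r x\<close> is the new dual vector, and the old ones are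
  corrected by multiples of it.\<close>

lemma dual_vectors:
  fixes f :: "nat \<Rightarrow> 'v \<Rightarrow> 'b"
  assumes add: "\<And>i. additive (f i)"
    and indep: "\<And>k. k < m \<Longrightarrow> \<nexists>c. \<forall>x. f k x = (\<Sum>i<k. c i * f i x)"
  shows "\<exists>u. \<forall>i<m. \<forall>j<m. f i (u j) = of_bool (i = j)"
  using indep
proof (induction m)
  case 0
  show ?case by simp
next
  case (Suc m)
  then obtain u where u: "\<And>i j. i < m \<Longrightarrow> j < m \<Longrightarrow> f i (u j) = of_bool (i = j)"
    using less_SucI by metis
  define r where "r x = x - (\<Sum>j<m. f j x *s u j)" for x
  have fr: "f i (r x) = f i x - (\<Sum>j<m. f j x * f i (u j))" for i x
    by (simp add: r_def additive.diff[OF add] additive.sum[OF add] functional_scale[OF add])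
  then have fr0: "f i (r x) = 0" if "i < m" for i x
    using that by (simp add: u of_bool_def if_distrib[of "\<lambda>b. _ * b"] cong: if_cong)
  have "\<not> (\<forall>x. f m x = (\<Sum>j<m. f m (u j) * f j x))"
  proof
    assume "\<forall>x. f m x = (\<Sum>j<m. f m (u j) * f j x)"
    then have "\<exists>c. \<forall>x. f m x = (\<Sum>j<m. c j * f j x)"
      by (rule exI[of _ "\<lambda>j. f m (u j)"])
    with Suc.prems[OF lessI] show False by blast
  qed
  then obtain x where "f m x \<noteq> (\<Sum>j<m. f m (u j) * f j x)"
    by blast
  then have "f m (r x) \<noteq> 0"
    by (simp add: fr mult.commute)
  then have fm: "f m (r x) = 1"
    using two_elems by blast
  define v where "v j = (if j = m then r x else u j - f m (u j) *s r x)" for j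
  have "f i (v j) = of_bool (i = j)" if "i < Suc m" "j < Suc m" for i j
    using that fr0 fm u[of i j]
    by (auto simp: v_def less_Suc_eq additive.diff[OF add] functional_scale[OF add])
  then show ?case by blast
qed

text \<open>The functionals \<open>F i\<close> are determined by their values on the finite set
  \<open>range p\<close>, so two of them coincide and a least dependent index \<open>m\<close>
  exists. Minimality makes the earlier ones independent; their dual vectors may be moved into
  \<open>range p\<close> since \<open>F i (p x) = F i x\<close>.\<close>

lemma cyclic_functionals:
  fixes f :: "'v \<Rightarrow> 'b"
  assumes T: "additive T" and p: "additive p" "\<And>x. p (p x) = p x" "finite (range p)"
    and Tp: "\<And>x. T (p x) = T x" and pT: "\<And>x. p (T x) = T x"
    and f: "additive f" "\<And>x. f (p x) = f x" "f x0 \<noteq> 0"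
  obtains m c u where "0 < m" "\<And>x. f ((T ^^ m) x) = (\<Sum>i<m. c i * f ((T ^^ i) x))"
    "\<And>i j. i < m \<Longrightarrow> j < m \<Longrightarrow> f ((T ^^ i) (u j)) = of_bool (i = j)" "\<And>j. p (u j) = u j"
proof -
  define F where "F i x = f ((T ^^ i) x)" for i x
  have addF: "additive (F i)" for i
  proof
    have "(T ^^ i) (x + y) = (T ^^ i) x + (T ^^ i) y" for x y
      by (induction i) (simp_all add: additive.add[OF T])
    then show "F i (x + y) = F i x + F i y" for x y
      by (simp add: F_def additive.add[OF f(1)])
  qed
  have Fp: "F i (p x) = F i x" for i x
    by (cases i) (simp_all add: F_def f Tp funpow_Suc_right del: funpow.simps(2))
  let ?dep = "\<lambda>m. \<exists>c. \<forall>x. F m x = (\<Sum>i<m. c i * F i x)"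
  have "\<exists>m. ?dep m"
  proof -
    have "finite (UNIV :: 'b set)"
      using two_elems finite_subset[of UNIV "{0, 1::'b}"] by auto
    then have "finite (range p \<rightarrow>\<^sub>E (UNIV :: 'b set))"
      by (intro finite_PiE p(3)) auto
    moreover have "range (\<lambda>i. restrict (F i) (range p)) \<subseteq> range p \<rightarrow>\<^sub>E UNIV"
      by auto
    ultimately have "finite (range (\<lambda>i. restrict (F i) (range p)))"
      by (rule rev_finite_subset)
    then have "\<not> inj (\<lambda>i. restrict (F i) (range p))"
      using finite_imageD infinite_UNIV_nat by blast
    then obtain i j where "i \<noteq> j" and eq: "restrict (F i) (range p) = restrict (F j) (range p)"
      by (auto simp: inj_def)
    have "F i x = F j x" for x
      using fun_cong[OF eq, of "p x"] by (simp add: Fp)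
    then obtain i j where "i < j" and eq: "\<And>x. F j x = F i x"
      using \<open>i \<noteq> j\<close> by (metis linorder_neqE_nat)
    then have "\<forall>x. F j x = (\<Sum>k<j. of_bool (k = i) * F k x)"
      by (simp add: of_bool_def if_distrib[of "\<lambda>b. b * _"] cong: if_cong)
    then show ?thesis
      by (intro exI[of _ j] exI[of _ "\<lambda>k. of_bool (k = i)"])
  qed
  define m where "m = (LEAST m. ?dep m)"
  have "?dep m"
    unfolding m_def using \<open>\<exists>m. ?dep m\<close> by (rule LeastI_ex)
  then obtain c where c: "\<And>x. F m x = (\<Sum>i<m. c i * F i x)"
    by blast
  have "m \<noteq> 0"
    using c[of x0] f(3) by (cases m) (auto simp: F_def)
  have "\<not> ?dep k" if "k < m" for k
    using that unfolding m_def by (rule not_less_Least)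
  then obtain u where "\<forall>i<m. \<forall>j<m. F i (u j) = of_bool (i = j)"
    using dual_vectors[of F m] addF by blast
  then show thesis
    using that[of m c "\<lambda>j. p (u j)"] \<open>m \<noteq> 0\<close> c Fp p(2) by (auto simp: F_def)
qed

text \<open>Induction on the size of \<open>range p\<close>. The common kernel of a cyclic family of
  functionals is \<open>T\<close>-invariant, and the dual vectors span a complement. The induction
  hypothesis handles \<open>T\<close> on the kernel, \<open>companion_split\<close> handles the
  quotient; \<open>E\<close> is the block-diagonal sum of the two idempotents, and
  \<open>T - E\<close> is block triangular with nilpotent blocks.\<close>

lemma nil_clean_operator:
  fixes T p :: "'v \<Rightarrow> 'v"
  assumes "additive T" "additive p" "\<And>x. p (p x) = p x" "finite (range p)"
    "\<And>x. T (p x) = T x" "\<And>x. p (T x) = T x"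
  shows "\<exists>E k. additive E \<and> (\<forall>x. p (E x) = E x) \<and> (\<forall>x. E (p x) = E x) \<and> (\<forall>x. E (E x) = E x) \<and>
           (\<forall>x. ((\<lambda>x. T x - E x) ^^ k) x = 0)"
  using assms
proof (induction "card (range p)" arbitrary: p T rule: less_induct)
  case less
  note T = \<open>additive T\<close> and p = \<open>additive p\<close> and pp = less.prems(3) and Tp = less.prems(5) and pT = less.prems(6)
  show ?case
  proof (cases "\<forall>x. p x = 0")
    case True
    then have "T x = 0" for x
      using pT[of x] by simp
    then show ?thesis
      using additive.zero[OF p] by (intro exI[of _ "\<lambda>_. 0"] exI[of _ 1]) (simp add: additive_def)
  next
    case False
    then obtain x0 where "p x0 \<noteq> 0"
      by blast
    from separating[OF this] obtain f0 :: "'v \<Rightarrow> 'b" where f0: "additive f0" "f0 (p x0) \<noteq> 0"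
      by blast
    have af: "additive (\<lambda>x. f0 (p x))"
      by standard (simp add: additive.add[OF f0(1)] additive.add[OF p])
    obtain m c u where "0 < m" and rec0: "\<And>x. f0 (p ((T ^^ m) x)) = (\<Sum>i<m. c i * f0 (p ((T ^^ i) x)))"
      and fu0: "\<And>i j. i < m \<Longrightarrow> j < m \<Longrightarrow> f0 (p ((T ^^ i) (u j))) = of_bool (i = j)"
      and pu: "\<And>j. p (u j) = u j"
      by (rule cyclic_functionals[OF T p pp \<open>finite (range p)\<close> Tp pT af _ f0(2)]) (simp only: pp, rule that)
    define f where "f i x = f0 (p ((T ^^ i) x))" for i x
    note rec = rec0[folded f_def] and fu = fu0[folded f_def]
    have addf: "additive (f i)" for i
    proof
      have "(T ^^ i) (x + y) = (T ^^ i) x + (T ^^ i) y" for x y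
        by (induction i) (simp_all add: additive.add[OF T])
      then show "f i (x + y) = f i x + f i y" for x y
        by (simp add: f_def additive.add[OF af])
    qed
    have fp: "f i (p x) = f i x" for i x
      by (cases i) (simp_all add: f_def pp Tp funpow_Suc_right del: funpow.simps(2))
    have fT: "f i (T x) = f (Suc i) x" for i x
      by (simp add: f_def funpow_Suc_right del: funpow.simps(2))
    obtain M where idem: "\<And>E. (\<forall>i<m. \<forall>x. f i (E x) = (\<Sum>j<m. M i j * f j x)) \<Longrightarrow>
         (\<forall>i<m. \<forall>x. (\<Sum>j<m. M i j * f j (E x)) = (\<Sum>j<m. M i j * f j x))"
      and nil: "\<And>Q. (\<forall>i<m. \<forall>x. f i (Q x) = f (Suc i) x - (\<Sum>j<m. M i j * f j x)) \<Longrightarrow>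
         \<exists>k. \<forall>i<m. \<forall>x. f i ((Q ^^ k) x) = 0"
      using companion_split[of f m c, OF two_elems rec] by blast
    define span where "span h = (\<lambda>x. \<Sum>i<m. h i x *s u i)" for h :: "nat \<Rightarrow> 'v \<Rightarrow> 'b"
    define g where "g i x = (\<Sum>j<m. M i j * f j x)" for i x
    have f_span: "f i (span h x) = h i x" if "i < m" for h i x
      using that by (simp add: span_def additive.sum[OF addf] functional_scale[OF addf] fu
          of_bool_def if_distrib[of "\<lambda>b. _ * b"] cong: if_cong)
    have additive_span: "additive (span h)" if "\<And>i. additive (h i)" for h
      by standard (simp add: span_def additive.add[OF that] scale_left_distrib sum.distrib)
    have p_span: "p (span h x) = span h x" for h x
    proof -
      have "p (b *s u i) = b *s u i" for b i
        using two_elems[of b] additive.zero[OF p] pu by auto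
      then show ?thesis by (simp add: span_def additive.sum[OF p])
    qed
    have addg: "additive (g i)" for i
      by standard (simp add: g_def additive.add[OF addf] distrib_left sum.distrib)
    \<comment> \<open>The projection of \<open>range p\<close> onto the common kernel of
      \<open>f 0, ..., f (m - 1)\<close> along the span of the dual vectors.\<close>
    define p' where "p' x = p x - span f x" for x
    have addp': "additive p'"
      by standard (simp add: p'_def additive.add[OF p] additive.add[OF additive_span[OF addf]])
    have fp': "f i (p' x) = 0" if "i < m" for i x
      using that by (simp add: p'_def additive.diff[OF addf] fp f_span)
    then have gp': "g i (p' x) = 0" for i x
      by (simp add: g_def)
    have span_fp': "span f (p' x) = 0" for x
      by (simp add: span_def fp')
    have pp': "p (p' x) = p' x" for x
      by (simp add: p'_def additive.diff[OF p] pp p_span)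
    have p'_id: "p' x = x" if "p x = x" "\<And>i. i < m \<Longrightarrow> f i x = 0" for x
      using that by (simp add: p'_def span_def)
    have p'p: "p' (p x) = p' x" for x
      by (simp add: p'_def pp fp span_def)
    have p'p': "p' (p' x) = p' x" for x
      using p'_id pp' fp' by blast
    have p'_span: "p' (span h x) = 0" for h x
      by (simp add: p'_def p_span) (simp add: span_def f_span[unfolded span_def])
    have sub: "range p' \<subset> range p"
    proof
      show "range p' \<subseteq> range p" using pp' by (metis image_subset_iff rangeI)
      have "f 0 (u 0) = 1" using fu[of 0 0] \<open>0 < m\<close> by simp
      then have "u 0 \<notin> range p'" using fp'[OF \<open>0 < m\<close>] by (metis imageE zero_neq_one)
      moreover have "u 0 \<in> range p" using pu by (metis rangeI)
      ultimately show "range p' \<noteq> range p" by blast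
    qed
    define T' where "T' x = p' (T (p' x))" for x
    have "\<exists>E k. additive E \<and> (\<forall>x. p' (E x) = E x) \<and> (\<forall>x. E (p' x) = E x) \<and> (\<forall>x. E (E x) = E x) \<and>
           (\<forall>x. ((\<lambda>x. T' x - E x) ^^ k) x = 0)"
    proof (rule less.hyps)
      show "card (range p') < card (range p)"
        using sub \<open>finite (range p)\<close> by (rule psubset_card_mono[rotated])
      show "additive T'"
        by standard (simp add: T'_def additive.add[OF addp'] additive.add[OF T])
      show "finite (range p')"
        using sub \<open>finite (range p)\<close> by (meson finite_subset psubset_imp_subset)
    qed (simp_all add: addp' p'p' T'_def)
    then obtain E' k' where E': "additive E'" "\<And>x. p' (E' x) = E' x" "\<And>x. E' (p' x) = E' x"
        "\<And>x. E' (E' x) = E' x" and nil': "\<And>x. ((\<lambda>x. T' x - E' x) ^^ k') x = 0"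
      by blast
    define E where "E x = E' x + span g x" for x
    have fE: "f i (E x) = g i x" if "i < m" for i x
      using fp'[OF that, of "E' x"] that by (simp add: E_def additive.add[OF addf] f_span E'(2))
    have pE': "p (E' x) = E' x" for x
      using pp'[of "E' x"] by (simp add: E'(2))
    have pE: "p (E x) = E x" for x
      by (simp add: E_def additive.add[OF p] pE' p_span)
    have E'_span: "E' (span h x) = 0" for h x
      using E'(3)[of "span h x"] additive.zero[OF E'(1)] by (simp add: p'_span)
    have gE: "g i (E x) = g i x" if "i < m" for i x
      using idem[of E] fE that by (simp add: g_def)
    have EE: "E (E x) = E x" for x
    proof -
      have "E' (E x) = E' x"
        by (simp add: E_def additive.add[OF E'(1)] E'(4) E'_span)
      moreover have "span g (E x) = span g x"
        by (simp add: span_def gE)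
      ultimately show ?thesis
        by (metis E_def)
    qed
    have E_p: "E (p x) = E x" for x
    proof -
      have "E' (p x) = E' x"
        using E'(3)[of "p x"] E'(3)[of x] by (simp add: p'p)
      then show ?thesis by (simp add: E_def span_def g_def fp)
    qed
    have addE: "additive E"
      by standard (simp add: E_def additive.add[OF E'(1)] additive.add[OF additive_span[OF addg]])
    define Q where "Q = (\<lambda>x. T x - E x)"
    define Q' where "Q' = (\<lambda>x. T' x - E' x)"
    have fQ: "f i (Q x) = f (Suc i) x - g i x" if "i < m" for i x
      using that by (simp add: Q_def additive.diff[OF addf] fT fE)
    then have "\<exists>k. \<forall>i<m. \<forall>x. f i ((Q ^^ k) x) = 0"
      by (intro nil) (simp add: g_def)
    then obtain k where k: "\<And>i x. i < m \<Longrightarrow> f i ((Q ^^ k) x) = 0"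
      by blast
    \<comment> \<open>The common kernel is \<open>Q\<close>-invariant because the next functional
      \<open>f m\<close>, like each \<open>g i\<close>, is a combination of
      \<open>f 0, ..., f (m - 1)\<close>.\<close>
    have f_Q0: "f i (Q x) = 0" if "i < m" "\<And>i. i < m \<Longrightarrow> f i x = 0" for i x
    proof -
      have "f j x = 0" if "j \<le> m" for j
        using that rec[of x] \<open>\<And>i. i < m \<Longrightarrow> f i x = 0\<close> by (cases "j = m") auto
      then show ?thesis using fQ that by (simp add: g_def)
    qed
    have pQ: "p (Q x) = Q x" for x
      by (simp add: Q_def additive.diff[OF p] pT pE)
    have Q_p': "Q (p' x) = Q' x" for x
    proof -
      have "p' (T (p' x) - E (p' x)) = T (p' x) - E (p' x)"
        using p'_id[of "Q (p' x)"] pQ f_Q0[OF _ fp'] by (simp add: Q_def)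
      moreover have "E (p' x) = E' x"
        by (simp add: E_def E' gp' span_def)
      ultimately show ?thesis
        by (simp add: Q_def Q'_def T'_def additive.diff[OF addp'] E'(2))
    qed
    have p'Q': "p' (Q' x) = Q' x" for x
      by (simp add: Q'_def T'_def additive.diff[OF addp'] p'p' E'(2))
    have pow: "(Q ^^ Suc j) (p' x) = (Q' ^^ Suc j) x" for j x
    proof (induction j)
      case 0
      show ?case by (simp add: Q_p')
    next
      case (Suc j)
      have "(Q ^^ Suc (Suc j)) (p' x) = Q (p' ((Q' ^^ Suc j) x))"
        using Suc by (simp add: p'Q')
      then show ?case by (simp add: Q_p')
    qed
    have Q'0: "Q' 0 = 0"
      by (simp add: Q'_def T'_def additive.zero[OF addp'] additive.zero[OF T] additive.zero[OF E'(1)])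
    \<comment> \<open>The first \<open>Suc k\<close> steps lead into the common kernel, where
      \<open>Q\<close> agrees with \<open>Q'\<close>. The extra steps take care of exponent 0: one
      application of \<open>Q\<close> ensures membership in \<open>range p\<close>, and
      \<open>pow\<close> starts at the first power.\<close>
    have "(Q ^^ (Suc k' + Suc k)) x = 0" for x
    proof -
      define y where "y = (Q ^^ Suc k) x"
      have "f i y = 0" if "i < m" for i
        unfolding y_def funpow.simps(2) comp_apply by (rule f_Q0[OF that k])
      moreover have "p y = y"
        by (simp add: y_def pQ)
      ultimately have "p' y = y" by (rule p'_id[rotated])
      then have "(Q ^^ Suc k') y = (Q' ^^ Suc k') y"
        using pow[of k' y] by simp
      also have "\<dots> = 0"
        using nil'[of y] by (simp add: Q'_def[symmetric] Q'0)
      finally show ?thesis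
        by (simp only: y_def funpow_add comp_apply)
    qed
    then show ?thesis
      using addE pE E_p EE unfolding Q_def by blast
  qed
qed

end

text \<open>The operator lemma is applied to the space of all sequences, since the vectors must form
  a type while \<open>n\<close> varies. There \<open>p\<close> truncates to the first
  \<open>n\<close> entries, and its range is finite because the field is.\<close>

lemma nil_clean_mat_two_elements:
  fixes A :: "'b::field mat"
  assumes two_elems: "\<And>b::'b. b = 0 \<or> b = 1"
    and A: "A \<in> carrier_mat n n"
  shows "\<exists>E \<in> carrier_mat n n. E * E = E \<and> (\<exists>k. (A - E) ^\<^sub>m k = 0\<^sub>m n n)"
proof -
  interpret two_element_space "\<lambda>(b::'b) x (i::nat). b * x i"
  proof
    fix x :: "nat \<Rightarrow> 'b" assume "x \<noteq> 0"
    then obtain i where "x i \<noteq> 0" by (auto simp: fun_eq_iff)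
    then show "\<exists>f::(nat \<Rightarrow> 'b) \<Rightarrow> 'b. additive f \<and> f x \<noteq> 0"
      by (intro exI[of _ "\<lambda>x. x i"]) (simp add: additive_def)
  qed (auto simp: fun_eq_iff algebra_simps two_elems)
  define p where "p x = (\<lambda>i. if i < n then x i else 0)" for x :: "nat \<Rightarrow> 'b"
  define op where "op B x = (\<lambda>i. if i < n then \<Sum>j<n. B $$ (i, j) * x j else 0)" for B and x :: "nat \<Rightarrow> 'b"
  define unit where "unit j = (\<lambda>i. of_bool (i = j) :: 'b)" for j :: nat
  have add_p: "additive p"
    by standard (auto simp: p_def)
  have add_op: "additive (op B)" for B
    by standard (auto simp: op_def algebra_simps sum.distrib)
  have sum_apply: "(\<Sum>j\<in>J. h j) i = (\<Sum>j\<in>J. h j i)" for J and h :: "nat \<Rightarrow> nat \<Rightarrow> 'b" and i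
    by (induction J rule: infinite_finite_induct) simp_all
  have "finite (range p)"
  proof -
    have "range p \<subseteq> (\<lambda>X i. of_bool (i \<in> X)) ` Pow {..<n}"
    proof
      fix y assume "y \<in> range p"
      then obtain x where y: "y = p x" by blast
      have "y = (\<lambda>i. of_bool (i \<in> {i. i < n \<and> x i = 1}))"
        using two_elems by (auto simp: y p_def fun_eq_iff)
      then show "y \<in> (\<lambda>X i. of_bool (i \<in> X)) ` Pow {..<n}"
        by (rule image_eqI) auto
    qed
    then show ?thesis by (rule finite_subset) simp
  qed
  moreover have "p (p x) = p x" "op A (p x) = op A x" "p (op A x) = op A x" for x
    by (simp_all add: p_def op_def fun_eq_iff)
  ultimately obtain E k where E: "additive E" "\<And>x. p (E x) = E x" "\<And>x. E (p x) = E x" "\<And>x. E (E x) = E x"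
      and nil: "\<And>x. ((\<lambda>x. op A x - E x) ^^ k) x = 0"
    using nil_clean_operator[of "op A" p, OF add_op add_p] by blast
  define F where "F = mat n n (\<lambda>(i, j). E (unit j) i)"
  have F: "F \<in> carrier_mat n n" by (simp add: F_def)
  have op_F: "op F x = E x" for x
  proof -
    have scale: "E (\<lambda>i. b * y i) i = b * E y i" for b y i
      using two_elems[of b] additive.zero[OF E(1)] by (auto simp: zero_fun_def)
    have "p x = (\<Sum>j<n. (\<lambda>i. x j * unit j i))"
      by (simp add: fun_eq_iff p_def sum_apply unit_def of_bool_def if_distrib[of "\<lambda>b. _ * b"] cong: if_cong)
    then have "E x = (\<Sum>j<n. E (\<lambda>i. x j * unit j i))"
      using E(3)[of x] by (simp add: additive.sum[OF E(1)])
    then have "E x i = (\<Sum>j<n. E (unit j) i * x j)" for i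
      by (simp add: sum_apply scale mult.commute)
    moreover have "E x i = 0" if "\<not> i < n" for i
      using E(2)[of x] that by (metis p_def)
    ultimately show ?thesis
      by (auto simp: fun_eq_iff op_def F_def)
  qed
  have op_mult: "op (B * C) x = op B (op C x)" if "B \<in> carrier_mat n n" "C \<in> carrier_mat n n" for B C x
  proof -
    have "(\<Sum>j<n. (\<Sum>k<n. B $$ (i, k) * C $$ (k, j)) * x j) = (\<Sum>k<n. B $$ (i, k) * (\<Sum>j<n. C $$ (k, j) * x j))" for i
      by (simp add: sum_distrib_left sum_distrib_right mult.assoc) (rule sum.swap)
    then show ?thesis
      using that by (auto simp: op_def fun_eq_iff scalar_prod_def atLeast0LessThan intro!: sum.cong)
  qed
  have op_minus: "op (A - F) x = op A x - E x" for x
    using F A by (auto simp: op_F[symmetric] fun_eq_iff op_def algebra_simps sum_subtractf)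
  have op_unit: "op B (unit j) i = B $$ (i, j)" if "i < n" "j < n" for B i j
    using that by (simp add: op_def unit_def of_bool_def if_distrib[of "\<lambda>b. _ * b"] cong: if_cong)
  have op_inj: "B = C" if "\<And>x. op B x = op C x" "B \<in> carrier_mat n n" "C \<in> carrier_mat n n" for B C
    using that op_unit by (intro eq_matI) (metis carrier_matD)+
  have "F * F = F"
    using F by (intro op_inj) (simp_all add: op_mult op_F E(4))
  moreover have "(A - F) ^\<^sub>m k = 0\<^sub>m n n"
  proof (rule op_inj)
    have AF: "A - F \<in> carrier_mat n n" using F by (rule minus_carrier_mat)
    define S where "S = (\<lambda>x. op A x - E x)"
    have op_S: "op (A - F) x = S x" for x
      by (simp only: op_minus S_def)
    have p_S: "p (S x) = S x" for x
      using E(2)[of x] unfolding S_def additive.diff[OF add_p] by (simp add: p_def op_def fun_eq_iff)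
    have "op A (p x) = op A x" for x
      by (simp add: p_def op_def fun_eq_iff)
    then have S_p: "S (p x) = S x" for x
      by (simp only: S_def E(3))
    \<comment> \<open>The truncation on the right is due to exponent 0: the identity matrix acts as
      \<open>p\<close>, not as the identity on sequences.\<close>
    have pow: "op ((A - F) ^\<^sub>m k) x = (S ^^ k) (p x)" for x
    proof (induction k arbitrary: x)
      case 0
      show ?case
        using carrier_matD(1)[OF F]
        by (simp add: op_def p_def fun_eq_iff if_distrib[of "\<lambda>b. b * _"] cong: if_cong)
    next
      case (Suc k)
      have "op ((A - F) ^\<^sub>m Suc k) x = op ((A - F) ^\<^sub>m k) (S x)"
        using AF by (simp add: op_mult[of _ "A - F"] op_S)
      then show ?case
        by (simp add: Suc p_S S_p funpow_Suc_right del: funpow.simps(2))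
    qed
    then show "op ((A - F) ^\<^sub>m k) x = op (0\<^sub>m n n) x" for x
      using nil by (simp only: S_def) (simp add: op_def fun_eq_iff)
  qed (use F in \<open>simp_all add: pow_carrier_mat minus_carrier_mat\<close>)
  ultimately show ?thesis
    using F by blast
qed

section \<open>Prime ideals and residue maps\<close>

definition is_prime_ideal :: "'a::comm_ring_1 set \<Rightarrow> bool" where
  "is_prime_ideal P \<longleftrightarrow> 0 \<in> P \<and> 1 \<notin> P \<and> (\<forall>a\<in>P. \<forall>b\<in>P. a + b \<in> P) \<and> (\<forall>r. \<forall>a\<in>P. r * a \<in> P) \<and>
    (\<forall>a b. a * b \<in> P \<longrightarrow> a \<in> P \<or> b \<in> P)"

lemma is_prime_idealD:
  assumes "is_prime_ideal P"
  shows "0 \<in> P" "1 \<notin> P" "a \<in> P \<Longrightarrow> b \<in> P \<Longrightarrow> a + b \<in> P" "a \<in> P \<Longrightarrow> r * a \<in> P"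
    "a \<in> P \<Longrightarrow> b \<in> P \<Longrightarrow> a - b \<in> P" "a * b \<in> P \<Longrightarrow> a \<in> P \<or> b \<in> P" "a ^ k \<in> P \<Longrightarrow> a \<in> P"
proof -
  show *: "0 \<in> P" "1 \<notin> P" "a \<in> P \<Longrightarrow> b \<in> P \<Longrightarrow> a + b \<in> P" "a \<in> P \<Longrightarrow> r * a \<in> P"
    "a * b \<in> P \<Longrightarrow> a \<in> P \<or> b \<in> P" for a b r
    using assms by (auto simp: is_prime_ideal_def)
  show "a \<in> P \<Longrightarrow> b \<in> P \<Longrightarrow> a - b \<in> P"
    using *(3)[of a "-1 * b"] *(4)[of b "-1"] by simp
  show "a ^ k \<in> P \<Longrightarrow> a \<in> P"
    using *(2) by (induction k) (auto dest: *(5))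
qed

text \<open>Zorn's lemma yields an ideal \<open>P\<close> maximal among those containing no power of
  \<open>x\<close>. Enlarging \<open>P\<close> by an element outside it captures a power of
  \<open>x\<close>; if \<open>a\<close> and \<open>b\<close> are outside but \<open>a * b\<close> is
  inside, the product of two such powers lies in \<open>P\<close>.\<close>

lemma prime_ideal_avoiding:
  fixes x :: "'a::comm_ring_1"
  assumes "\<And>k. x ^ k \<noteq> 0"
  obtains P where "is_prime_ideal P" "x \<notin> P"
proof -
  define idl where "idl I \<longleftrightarrow> 0 \<in> I \<and> (\<forall>a\<in>I. \<forall>b\<in>I. a + b \<in> I) \<and> (\<forall>r. \<forall>a\<in>I. r * a \<in> I)" for I :: "'a set"
  define \<I> where "\<I> = {I. idl I \<and> (\<forall>k. x ^ k \<notin> I)}"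
  have "\<exists>M\<in>\<I>. \<forall>I\<in>\<I>. M \<subseteq> I \<longrightarrow> I = M"
  proof (rule subset_Zorn_nonempty)
    show "\<I> \<noteq> {}"
      using assms by (auto simp: \<I>_def idl_def intro!: exI[of _ "{0}"])
  next
    fix \<C> assume ne: "\<C> \<noteq> {}" and chain: "subset.chain \<I> \<C>"
    have \<C>: "idl I" "x ^ k \<notin> I" if "I \<in> \<C>" for I k
      using that chain by (auto simp: subset.chain_def \<I>_def)
    have "a + b \<in> \<Union>\<C>" if ab: "a \<in> \<Union>\<C>" "b \<in> \<Union>\<C>" for a b
    proof -
      obtain I J where IJ: "a \<in> I" "I \<in> \<C>" "b \<in> J" "J \<in> \<C>" using ab by blast
      then consider "I \<subseteq> J" | "J \<subseteq> I"
        using chain by (auto simp: subset.chain_def)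
      then have "\<exists>K\<in>\<C>. a \<in> K \<and> b \<in> K"
        using IJ by cases blast+
      then show ?thesis
        using \<C>(1) by (auto simp: idl_def)
    qed
    moreover have "r * a \<in> \<Union>\<C>" if "a \<in> \<Union>\<C>" for a r
      using that \<C>(1) unfolding idl_def by blast
    moreover have "0 \<in> \<Union>\<C>"
      using ne \<C>(1) by (auto simp: idl_def)
    ultimately have "idl (\<Union>\<C>)"
      unfolding idl_def by (intro conjI ballI allI)
    then show "\<Union>\<C> \<in> \<I>"
      using \<C>(2) by (auto simp: \<I>_def)
  qed
  then obtain P where P: "idl P" "\<And>k. x ^ k \<notin> P" and max: "\<And>I. I \<in> \<I> \<Longrightarrow> P \<subseteq> I \<Longrightarrow> I = P"
    by (auto simp: \<I>_def)
  have meets: "\<exists>k r. \<exists>p\<in>P. x ^ k = p + r * a" if "a \<notin> P" for a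
  proof (rule ccontr)
    assume no: "\<not> ?thesis"
    define I where "I = {p + r * a | p r. p \<in> P}"
    have "idl I"
      unfolding idl_def
    proof (intro conjI ballI allI)
      show "0 \<in> I"
        using P(1) by (auto simp: I_def idl_def intro!: exI[of _ 0])
      fix b c r assume "b \<in> I"
      then obtain p s where b: "b = p + s * a" "p \<in> P" by (auto simp: I_def)
      have "r * b = r * p + (r * s) * a" by (simp add: b algebra_simps)
      then show "r * b \<in> I" using b P(1) unfolding I_def idl_def by blast
      assume "c \<in> I"
      then obtain q t where c: "c = q + t * a" "q \<in> P" by (auto simp: I_def)
      have "b + c = (p + q) + (s + t) * a" by (simp add: b c algebra_simps)
      then show "b + c \<in> I" using b c P(1) unfolding I_def idl_def by blast
    qed
    moreover have "P \<subseteq> I"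
    proof
      fix p assume "p \<in> P"
      then have "p = p + 0 * a \<and> p \<in> P" by simp
      then show "p \<in> I" unfolding I_def by blast
    qed
    ultimately have "I = P"
      using no by (intro max) (auto simp: \<I>_def I_def)
    moreover have "a = 0 + 1 * a \<and> 0 \<in> P"
      using P(1) by (simp add: idl_def)
    then have "a \<in> I" unfolding I_def by blast
    ultimately show False using that by simp
  qed
  have "a \<in> P \<or> b \<in> P" if ab: "a * b \<in> P" for a b
  proof (rule ccontr)
    assume "\<not> ?thesis"
    then obtain k p r l q s where 1: "x ^ k = p + r * a" "p \<in> P" and 2: "x ^ l = q + s * b" "q \<in> P"
      using meets by metis
    have "x ^ (k + l) = (q + s * b) * p + ((r * a) * q + (r * s) * (a * b))"
      by (simp add: power_add 1 2 algebra_simps)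
    also have "\<dots> \<in> P"
      using P(1) 1 2 ab unfolding idl_def by blast
    finally show False using P(2) by blast
  qed
  then have "is_prime_ideal P"
    using P(1) P(2)[of 0] unfolding is_prime_ideal_def idl_def by simp
  moreover have "x \<notin> P" using P(2)[of 1] by simp
  ultimately show thesis by (rule that)
qed

text \<open>If every class modulo \<open>P\<close> contains an integer, the residue map can be
  written directly into a concrete ring \<open>'f\<close> by choosing such an integer;
  \<open>ker\<close> makes the value independent of the choice.\<close>

lemma residue_hom:
  fixes P :: "'a::comm_ring_1 set"
  assumes P: "is_prime_ideal P"
    and rep: "\<And>x. \<exists>z. x - of_int z \<in> P"
    and ker: "\<And>z. (of_int z :: 'a) \<in> P \<Longrightarrow> (of_int z :: 'f::comm_ring_1) = 0"
  obtains \<phi> :: "'a \<Rightarrow> 'f::comm_ring_1" where "comm_ring_hom \<phi>" "\<And>x z. x - of_int z \<in> P \<Longrightarrow> \<phi> x = of_int z"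
proof -
  define \<phi> where "\<phi> x = (of_int (SOME z. x - of_int z \<in> P) :: 'f)" for x
  have \<phi>: "\<phi> x = of_int z" if "x - of_int z \<in> P" for x z
  proof -
    have "x - of_int (SOME z. x - of_int z \<in> P) \<in> P"
      using rep[of x] by (rule someI_ex)
    from is_prime_idealD(5)[OF P this that]
    have "of_int (z - (SOME z. x - of_int z \<in> P)) \<in> P" by simp
    from ker[OF this] show ?thesis by (simp add: \<phi>_def)
  qed
  have "comm_ring_hom \<phi>"
  proof
    fix x y
    obtain z w where zw: "x - of_int z \<in> P" "y - of_int w \<in> P" using rep by blast
    have "x + y - of_int (z + w) \<in> P"
      using is_prime_idealD(3)[OF P zw] by (simp add: algebra_simps)
    then show "\<phi> (x + y) = \<phi> x + \<phi> y"
      using \<phi> zw \<phi>[of "x + y" "z + w"] by simp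
    have "x * y - of_int (z * w) = y * (x - of_int z) + of_int z * (y - of_int w)"
      by (simp add: algebra_simps)
    also have "\<dots> \<in> P"
      using zw by (intro is_prime_idealD(3,4)[OF P])
    finally show "\<phi> (x * y) = \<phi> x * \<phi> y"
      using \<phi> zw \<phi>[of "x * y" "z * w"] by simp
  next
    show "\<phi> 0 = 0" "\<phi> 1 = 1"
      using \<phi>[of 0 0] \<phi>[of 1 1] is_prime_idealD(1)[OF P] by simp_all
  qed
  then show thesis using \<phi> by (rule that)
qed

text \<open>Primality puts \<open>c\<close> or \<open>c - 1\<close> in \<open>P\<close>, so 0 and 1
  represent all classes; at \<open>c = 2\<close> the hypothesis reads \<open>2 \<in> P\<close>, so
  integers in \<open>P\<close> are even.\<close>

lemma residue_hom_bit:
  fixes P :: "'a::comm_ring_1 set"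
  assumes P: "is_prime_ideal P" and boolean: "\<And>c. c * (c - 1) \<in> P"
  obtains \<phi> :: "'a \<Rightarrow> bit" where "comm_ring_hom \<phi>" "\<And>x. x \<notin> P \<Longrightarrow> \<phi> x = 1"
proof -
  note D = is_prime_idealD[OF P]
  have cases: "c \<in> P \<or> c - 1 \<in> P" for c
    using boolean D(6) by blast
  have two: "2 \<in> P"
    using boolean[of 2] by simp
  have "\<exists>z. c - of_int z \<in> P" for c
    using cases[of c] by (metis diff_zero of_int_0 of_int_1)
  moreover have "(of_int z :: bit) = 0" if "(of_int z :: 'a) \<in> P" for z
  proof -
    have "even z"
    proof (rule ccontr)
      assume "odd z"
      then obtain w where "z = 2 * w + 1" by (elim oddE)
      then have "(1::'a) = of_int z - of_int w * 2" by simp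
      also have "\<dots> \<in> P" using that two by (intro D(5,4))
      finally show False using D(2) by simp
    qed
    then show ?thesis by (elim evenE) simp
  qed
  ultimately obtain \<phi> :: "'a \<Rightarrow> bit" where \<phi>: "comm_ring_hom \<phi>" "\<And>x z. x - of_int z \<in> P \<Longrightarrow> \<phi> x = of_int z"
    using residue_hom[OF P] by metis
  show thesis
    using that[OF \<phi>(1)] \<phi>(2)[of _ 1] cases by auto
qed

text \<open>The classes are those of 0, 1 and -1. At \<open>c = 2\<close> one of 2, 1 and 3 lies in
  \<open>P\<close>, and only 3 can.\<close>

lemma residue_hom_3:
  fixes P :: "'a::comm_ring_1 set"
  assumes P: "is_prime_ideal P" and "2 \<notin> P" and cube: "\<And>c. c * ((c - 1) * (c + 1)) \<in> P"
  obtains \<phi> :: "'a \<Rightarrow> 3" where "comm_ring_hom \<phi>"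
proof -
  note D = is_prime_idealD[OF P]
  have cases: "c \<in> P \<or> c - 1 \<in> P \<or> c + 1 \<in> P" for c
    using cube D(6) by blast
  have three: "3 \<in> P"
    using cases[of 2] \<open>2 \<notin> P\<close> D(2) by simp
  have "\<exists>z. c - of_int z \<in> P" for c
    using cases[of c] by (metis diff_zero of_int_0 of_int_1 of_int_minus diff_minus_eq_add)
  moreover have "(of_int z :: 3) = 0" if "(of_int z :: 'a) \<in> P" for z
  proof -
    define w r where "w = z div 3" and "r = z mod 3"
    have z: "z = 3 * w + r" by (simp add: w_def r_def)
    then have "of_int r = of_int z - of_int w * (3::'a)" by simp
    also have "\<dots> \<in> P" using that three by (intro D(5,4))
    finally have "of_int r \<in> P" .
    moreover have "r = 0 \<or> r = 1 \<or> r = 2"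
      using pos_mod_bound[of 3 z] pos_mod_sign[of 3 z] unfolding r_def by linarith
    ultimately have "r = 0"
      using D(2) \<open>2 \<notin> P\<close> by auto
    moreover have "(3::3) = 0" by simp
    ultimately show ?thesis using z by (metis add.right_neutral mult_zero_left of_int_mult of_int_numeral)
  qed
  ultimately show thesis
    using residue_hom[OF P] that by metis
qed

lemma three_cases: "x = 0 \<or> x = 1 \<or> x = 2" for x :: 3
proof (cases x)
  case (of_int z)
  then have "z = 0 \<or> z = 1 \<or> z = 2" by auto
  then show ?thesis using of_int by auto
qed

section \<open>Decompositions of singular matrices\<close>

lemma index_mult_mat_sum:
  assumes "A \<in> carrier_mat m n" "B \<in> carrier_mat n l" "i < m" "j < l"
  shows "(A * B) $$ (i, j) = (\<Sum>k<n. A $$ (i, k) * B $$ (k, j))"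
  using assms by (auto simp: scalar_prod_def atLeast0LessThan intro!: sum.cong)

lemma index_mult_mat_vec_sum:
  assumes "A \<in> carrier_mat m n" "v \<in> carrier_vec n" "i < m"
  shows "(A *\<^sub>v v) $ i = (\<Sum>k<n. A $$ (i, k) * v $ k)"
  using assms by (auto simp: scalar_prod_def atLeast0LessThan intro!: sum.cong)

lemma pow_mat_add:
  assumes "A \<in> carrier_mat n n"
  shows "A ^\<^sub>m (k + l) = A ^\<^sub>m k * A ^\<^sub>m l"
proof -
  interpret semiring "ring_mat TYPE('a) n ()" by (rule semiring_mat)
  have "A \<in> carrier (ring_mat TYPE('a) n ())" using assms by (simp add: ring_mat_simps)
  from nat_pow_mult[OF this, of k l] show ?thesis
    using assms by (simp add: pow_mat_ring_pow[where b = "()"] ring_mat_simps)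
qed

lemma pow_mat_mult:
  assumes "A \<in> carrier_mat n n"
  shows "A ^\<^sub>m (k * l) = (A ^\<^sub>m k) ^\<^sub>m l"
proof (induction l)
  case 0
  show ?case using assms by simp
next
  case (Suc l)
  then show ?case
    using pow_mat_add[OF assms, of "k * l" k] by (simp add: add.commute)
qed

lemma pow_mat_smult:
  fixes A :: "'a::comm_ring_1 mat"
  assumes A: "A \<in> carrier_mat n n"
  shows "(a \<cdot>\<^sub>m A) ^\<^sub>m k = a ^ k \<cdot>\<^sub>m (A ^\<^sub>m k)"
proof (induction k)
  case 0
  show ?case using A by auto
next
  case (Suc k)
  have Ak: "A ^\<^sub>m k \<in> carrier_mat n n" using A by (rule pow_carrier_mat)
  have "(a ^ k \<cdot>\<^sub>m (A ^\<^sub>m k)) * (a \<cdot>\<^sub>m A) = a ^ k \<cdot>\<^sub>m (a \<cdot>\<^sub>m ((A ^\<^sub>m k) * A))"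
    using A Ak by (simp add: mult_smult_assoc_mat[of _ n n _ n] mult_smult_distrib[of _ n n _ n])
      (intro eq_matI, auto simp: mult_ac)
  with Suc show ?case
    by (intro eq_matI) (auto simp: mult_ac)
qed

lemma pow_mat_eigenvector:
  fixes A :: "'a::comm_ring_1 mat"
  assumes A: "A \<in> carrier_mat n n" and v: "v \<in> carrier_vec n" and eig: "A *\<^sub>v v = a \<cdot>\<^sub>v v"
  shows "(A ^\<^sub>m k) *\<^sub>v v = a ^ k \<cdot>\<^sub>v v"
proof (induction k)
  case 0
  show ?case using A v by simp
next
  case (Suc k)
  have Ak: "A ^\<^sub>m k \<in> carrier_mat n n" using A by (rule pow_carrier_mat)
  have "(A ^\<^sub>m Suc k) *\<^sub>v v = (A ^\<^sub>m k) *\<^sub>v (A *\<^sub>v v)"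
    using assoc_mult_mat_vec[OF Ak A v] by simp
  also have "\<dots> = a \<cdot>\<^sub>v (A ^\<^sub>m k *\<^sub>v v)"
    unfolding eig using Ak v by (intro eq_vecI) auto
  finally show ?case
    using Suc by (simp add: smult_smult_assoc)
qed

lemma nilpotent_eigenvector:
  fixes A :: "'a::comm_ring_1 mat"
  assumes A: "A \<in> carrier_mat n n" "A ^\<^sub>m k = 0\<^sub>m n n" and v: "v \<in> carrier_vec n"
    and eig: "A *\<^sub>v v = a \<cdot>\<^sub>v v" and "i < n"
  shows "a ^ k * v $ i = 0"
proof -
  have "a ^ k \<cdot>\<^sub>v v = 0\<^sub>m n n *\<^sub>v v"
    using pow_mat_eigenvector[OF A(1) v eig, of k] by (simp add: A(2))
  also have "\<dots> = 0\<^sub>v n" using v by (intro eq_vecI) auto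
  finally have "(a ^ k \<cdot>\<^sub>v v) $ i = 0\<^sub>v n $ i" by simp
  then show ?thesis using v \<open>i < n\<close> by simp
qed

text \<open>In the next lemma \<open>v\<close> splits into the eigenvectors \<open>e v\<close> and \<open>v - e v\<close> of \<open>q\<close>.\<close>

lemma near_scalar_annihilates:
  fixes q e :: "'a::comm_ring_1 mat"
  assumes q: "q \<in> carrier_mat n n" "q ^\<^sub>m k = 0\<^sub>m n n" and e: "e \<in> carrier_mat n n" "e * e = e"
    and sum: "mat n n (\<lambda>(i, j). of_bool (i = j \<and> i \<noteq> l) * c) = q + s \<cdot>\<^sub>m e"
    and v: "v \<in> carrier_vec n" "v $ l = 0" "(e *\<^sub>v v) $ l = 0" and l: "l < n" and i: "i < n"
  shows "(c * (c - s)) ^ k * v $ i = 0"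
proof -
  \<comment> \<open>On vectors vanishing at \<open>l\<close> the diagonal matrix acts as the scalar
    \<open>c\<close>, hence \<open>q\<close> as \<open>c - s e\<close>.\<close>
  have eig: "q *\<^sub>v w = t \<cdot>\<^sub>v w"
    if w: "w \<in> carrier_vec n" "w $ l = 0" "\<And>i. i < n \<Longrightarrow> c * w $ i - s * (e *\<^sub>v w) $ i = t * w $ i" for w t
  proof (rule eq_vecI)
    fix i assume "i < dim_vec (t \<cdot>\<^sub>v w)"
    then have i: "i < n" using w by simp
    have "q $$ (i, j) = of_bool (i = j \<and> i \<noteq> l) * c - s * e $$ (i, j)" if "j < n" for j
      using arg_cong[OF sum, of "\<lambda>A. A $$ (i, j)"] i that e(1) q(1) by (simp add: algebra_simps)
    then have "(q *\<^sub>v w) $ i = (\<Sum>j<n. of_bool (i = j \<and> i \<noteq> l) * c * w $ j - s * (e $$ (i, j) * w $ j))"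
      unfolding index_mult_mat_vec_sum[OF q(1) w(1) i]
      by (intro sum.cong) (simp_all add: left_diff_distrib mult.assoc)
    also have "\<dots> = (\<Sum>j<n. of_bool (i = j \<and> i \<noteq> l) * c * w $ j) - s * (e *\<^sub>v w) $ i"
      by (simp only: sum_subtractf sum_distrib_left index_mult_mat_vec_sum[OF e(1) w(1) i])
    also have "(\<Sum>j<n. of_bool (i = j \<and> i \<noteq> l) * c * w $ j) = c * w $ i"
      using i w(2) by (cases "i = l")
        (simp_all add: of_bool_def if_distrib[of "\<lambda>b. b * _"] cong: if_cong)
    finally show "(q *\<^sub>v w) $ i = (t \<cdot>\<^sub>v w) $ i"
      using w i by simp
  qed (use q w in simp_all)
  define a where "a = e *\<^sub>v v"
  have a: "a \<in> carrier_vec n" using e v by (simp add: a_def)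
  have ea: "e *\<^sub>v a = a"
    using e v(1) by (simp add: a_def assoc_mult_mat_vec[symmetric])
  have va: "(v - a) $ l = 0"
    using v a l by (simp add: index_minus_vec carrier_vecD flip: a_def)
  \<comment> \<open>The eigenvalue of \<open>q\<close> is \<open>c - s\<close> on \<open>e v\<close>
    and \<open>c\<close> on \<open>v - e v\<close>; the product of the two annihilating powers kills
    both parts of \<open>v\<close>.\<close>
  have "(c - s) ^ k * a $ i = 0"
    using v(3) by (intro nilpotent_eigenvector[OF q a _ i] eig a) (simp_all add: ea algebra_simps flip: a_def)
  moreover have "c ^ k * (v - a) $ i = 0"
  proof (intro nilpotent_eigenvector[OF q _ _ i] eig)
    fix j assume "j < n"
    have "e *\<^sub>v (v - a) = 0\<^sub>v n"
      using mult_minus_distrib_mat_vec[OF e(1) v(1) a] a by (simp add: ea flip: a_def)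
    then show "c * (v - a) $ j - s * (e *\<^sub>v (v - a)) $ j = c * (v - a) $ j"
      using \<open>j < n\<close> by simp
  qed (use v a va in simp_all)
  then have "c ^ k * v $ i = c ^ k * a $ i"
    using v a i by (simp add: algebra_simps)
  ultimately show ?thesis
    by (simp add: power_mult_distrib) (metis mult.assoc mult.commute mult_zero_right)
qed

section \<open>Decompositions of matrices with a zero row\<close>

lemma ring_mat_minus:
  fixes A B :: "'a::comm_ring_1 mat"
  assumes "A \<in> carrier_mat n n" "B \<in> carrier_mat n n"
  shows "A \<ominus>\<^bsub>ring_mat TYPE('a) n b\<^esub> B = A - B"
proof -
  interpret ring "ring_mat TYPE('a) n b" by (rule ring_mat)
  have "- B \<oplus>\<^bsub>ring_mat TYPE('a) n b\<^esub> B = \<zero>\<^bsub>ring_mat TYPE('a) n b\<^esub>"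
    using assms by (simp add: ring_mat_simps)
  then have "\<ominus>\<^bsub>ring_mat TYPE('a) n b\<^esub> B = - B"
    using assms by (intro minus_equality) (simp_all add: ring_mat_simps)
  then show ?thesis
    using assms by (simp add: a_minus_def ring_mat_simps add_uminus_minus_mat)
qed

lemma zero_row_not_unit:
  fixes A :: "'a::comm_ring_1 mat"
  assumes A: "A \<in> carrier_mat n n" and "i < n" and zero: "\<And>j. j < n \<Longrightarrow> A $$ (i, j) = 0"
  shows "A \<notin> Units (ring_mat TYPE('a) n b)"
proof
  assume "A \<in> Units (ring_mat TYPE('a) n b)"
  then obtain B where B: "B \<in> carrier_mat n n" "A * B = 1\<^sub>m n"
    by (auto simp: Units_def ring_mat_simps)
  have "(A * B) $$ (i, i) = 0"
    using index_mult_mat_sum[OF A B(1) \<open>i < n\<close> \<open>i < n\<close>] zero by simp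
  then show False
    using B(2) \<open>i < n\<close> by simp
qed

lemma GWNC_mat_decomposition:
  fixes A :: "'a::comm_ring_1 mat"
  assumes "GWNC (ring_mat TYPE('a) n ())" and A: "A \<in> carrier_mat n n"
    and "i < n" "\<And>j. j < n \<Longrightarrow> A $$ (i, j) = 0"
  obtains s q e k where "s = 1 \<or> s = -1" "q \<in> carrier_mat n n" "q ^\<^sub>m k = 0\<^sub>m n n"
    "e \<in> carrier_mat n n" "e * e = e" "A = q + s \<cdot>\<^sub>m e"
proof -
  have "A \<in> carrier (ring_mat TYPE('a) n ()) - Units (ring_mat TYPE('a) n ())"
    using zero_row_not_unit[OF assms(2-4)] A by (simp add: ring_mat_simps)
  then obtain q e where q: "q \<in> nilpotent_elems (ring_mat TYPE('a) n ())"
    and e: "e \<in> idempotent_elems (ring_mat TYPE('a) n ())"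
    and sum: "A = q \<oplus>\<^bsub>ring_mat TYPE('a) n ()\<^esub> e \<or> A = q \<ominus>\<^bsub>ring_mat TYPE('a) n ()\<^esub> e"
    using assms(1) unfolding GWNC_def by blast
  from q obtain k where q': "q \<in> carrier_mat n n" "q ^\<^sub>m k = 0\<^sub>m n n"
    by (auto simp: nilpotent_elems_def ring_mat_simps pow_mat_ring_pow[where b = "()"])
  from e have e': "e \<in> carrier_mat n n" "e * e = e"
    by (auto simp: idempotent_elems_def ring_mat_simps)
  have "A = q + 1 \<cdot>\<^sub>m e \<or> A = q + (-1) \<cdot>\<^sub>m e"
    using sum
  proof
    assume "A = q \<ominus>\<^bsub>ring_mat TYPE('a) n ()\<^esub> e"
    then have "A = q + (-1) \<cdot>\<^sub>m e"
      unfolding ring_mat_minus[OF q'(1) e'(1)] using q'(1) e'(1) by (auto intro!: eq_matI)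
    then show ?thesis ..
  qed (auto simp: ring_mat_simps intro!: eq_matI)
  then show thesis
    using that q' e' by metis
qed

lemma GWNC_mat_imp_nilpotent:
  fixes c :: "'a::comm_ring_1"
  assumes "GWNC (ring_mat TYPE('a) n ())" "n \<ge> 3"
  obtains s k where "s = 1 \<or> s = -1" "(c * (c - s)) ^ k = 0"
proof -
  define A where "A = mat n n (\<lambda>(i, j). of_bool (i = j \<and> i \<noteq> (2::nat)) * c)"
  have A: "A \<in> carrier_mat n n" "2 < n" "\<And>j. j < n \<Longrightarrow> A $$ (2, j) = 0"
    using assms(2) by (simp_all add: A_def)
  obtain s q e k where s: "s = 1 \<or> s = -1" and q: "q \<in> carrier_mat n n" "q ^\<^sub>m k = 0\<^sub>m n n"
    and e: "e \<in> carrier_mat n n" "e * e = e" and sum: "A = q + s \<cdot>\<^sub>m e"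
    using GWNC_mat_decomposition[OF assms(1) A] by metis
  define d where "d = (c * (c - s)) ^ k"
  note ann = near_scalar_annihilates[OF q e sum[unfolded A_def], folded d_def]
  have idx: "0 < n" "1 < n" "2 < n" using assms(2) by simp_all
  have pick: "(\<Sum>j<n. f j * (of_bool (j = l) * b)) = f l * b" if "l < n" for f l and b :: 'a
    using that by (simp add: of_bool_def if_distrib[of "\<lambda>b. b * _"] if_distrib[of "\<lambda>b. _ * b"] cong: if_cong)
  \<comment> \<open>The entries are chosen so that row 2 of \<open>e\<close> kills \<open>v\<close>;
    annihilation at coordinate 1 then gives \<open>d * e $$ (2, 0) = 0\<close>.\<close>
  define v where "v = vec n (\<lambda>j. of_bool (j = 0) * e $$ (2, 1) - of_bool (j = 1) * e $$ (2, 0))"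
  have "(e *\<^sub>v v) $ 2 = (\<Sum>j<n. e $$ (2, j) * (of_bool (j = 0) * e $$ (2, 1))
      - e $$ (2, j) * (of_bool (j = 1) * e $$ (2, 0)))"
    using idx e by (subst index_mult_mat_vec_sum[of e n n]) (auto simp: v_def right_diff_distrib intro!: sum.cong)
  also have "\<dots> = 0"
    unfolding sum_subtractf using idx by (simp only: pick) (simp add: mult.commute)
  finally have "d * v $ 1 = 0"
    using idx by (intro ann) (simp_all add: v_def)
  then have de: "d * e $$ (2, 0) = 0"
    using idx by (simp add: v_def)
  \<comment> \<open>After scaling by \<open>d\<close> the unit vector is killed by row 2 of
    \<open>e\<close> as well, and annihilation gives \<open>d * d = 0\<close>.\<close>
  define w where "w = vec n (\<lambda>j. of_bool (j = 0) * d)"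
  have "(e *\<^sub>v w) $ 2 = (\<Sum>j<n. e $$ (2, j) * (of_bool (j = 0) * d))"
    using idx e by (subst index_mult_mat_vec_sum[of e n n]) (auto simp: w_def intro!: sum.cong)
  also have "\<dots> = 0"
    using idx de by (simp only: pick) (simp add: mult.commute)
  finally have "d * w $ 0 = 0"
    using idx by (intro ann) (simp_all add: w_def)
  then have "(c * (c - s)) ^ (k + k) = 0"
    using idx by (simp add: w_def d_def power_add)
  with s show thesis by (rule that)
qed

section \<open>Traces and idempotents over the field with three elements\<close>

lemma three_mult: "3 * x = 0" for x :: 3
  using three_cases[of x] by auto

text \<open>Rotation permutes the index triples; its orbits off the diagonal have three members,
  whose equal contributions add up to 0.\<close>

lemma sum_cyclic_3:
  fixes F :: "nat \<Rightarrow> nat \<Rightarrow> nat \<Rightarrow> 3"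
  assumes cyc: "\<And>i j k. F i j k = F j k i"
  shows "(\<Sum>i<n. \<Sum>j<n. \<Sum>k<n. F i j k) = (\<Sum>i<n. F i i i)"
proof (induction n)
  case 0
  show ?case by simp
next
  case (Suc n)
  have "(\<Sum>i<n. \<Sum>k<n. F i n k) = (\<Sum>i<n. \<Sum>k<n. F k i n)"
    using cyc by (intro sum.cong refl) metis
  also have "\<dots> = (\<Sum>i<n. \<Sum>j<n. F i j n)" by (rule sum.swap)
  finally have 1: "(\<Sum>i<n. \<Sum>k<n. F i n k) = (\<Sum>i<n. \<Sum>j<n. F i j n)" .
  have 2: "(\<Sum>j<n. \<Sum>k<n. F n j k) = (\<Sum>i<n. \<Sum>j<n. F i j n)"
    using cyc by (intro sum.cong refl)
  have 3: "(\<Sum>i<n. F n i n) = (\<Sum>i<n. F i n n)" "(\<Sum>i<n. F n n i) = (\<Sum>i<n. F i n n)"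
    using cyc by (metis (no_types, lifting) sum.cong)+
  show ?case
    by (simp add: sum.distrib Suc 1 2 3 add_ac three_mult)
qed

lemma cube_3: "x * (x * x) = x" for x :: 3
  using three_cases[of x] by auto

text \<open>A Frobenius identity for the trace: in the cyclic expansion only the cubes of the
  diagonal entries remain, and these equal the entries.\<close>

lemma trace_cube_3:
  fixes A :: "3 mat"
  assumes A: "A \<in> carrier_mat n n"
  shows "(\<Sum>i<n. (A ^\<^sub>m 3) $$ (i, i)) = (\<Sum>i<n. A $$ (i, i))"
proof -
  have AA: "A * A \<in> carrier_mat n n" using A by simp
  have "A ^\<^sub>m 3 = A * A * A"
    using A by (simp add: numeral_3_eq_3)
  moreover have "(A * A * A) $$ (i, i) = (\<Sum>j<n. \<Sum>k<n. A $$ (i, j) * (A $$ (j, k) * A $$ (k, i)))"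
    if "i < n" for i
  proof -
    have "(A * A * A) $$ (i, i) = (\<Sum>k<n. \<Sum>j<n. A $$ (i, j) * (A $$ (j, k) * A $$ (k, i)))"
      using that by (simp add: index_mult_mat_sum[OF AA A] index_mult_mat_sum[OF A A] sum_distrib_right mult.assoc
        del: index_mult_mat)
    also have "\<dots> = (\<Sum>j<n. \<Sum>k<n. A $$ (i, j) * (A $$ (j, k) * A $$ (k, i)))"
      by (rule sum.swap)
    finally show ?thesis .
  qed
  ultimately have "(\<Sum>i<n. (A ^\<^sub>m 3) $$ (i, i)) = (\<Sum>i<n. \<Sum>j<n. \<Sum>k<n. A $$ (i, j) * (A $$ (j, k) * A $$ (k, i)))"
    by simp
  also have "\<dots> = (\<Sum>i<n. A $$ (i, i) * (A $$ (i, i) * A $$ (i, i)))"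
    by (rule sum_cyclic_3) (simp add: mult_ac)
  finally show ?thesis
    by (simp only: cube_3)
qed

text \<open>By iterating the cube identity, \<open>A\<close> has the same trace as its power with
  exponent \<open>3 ^ k\<close>, which is 0 because \<open>3 ^ k \<ge> k\<close>.\<close>

lemma trace_nilpotent_3:
  fixes A :: "3 mat"
  assumes A: "A \<in> carrier_mat n n" and nil: "A ^\<^sub>m k = 0\<^sub>m n n"
  shows "(\<Sum>i<n. A $$ (i, i)) = 0"
proof -
  have tr: "(\<Sum>i<n. (A ^\<^sub>m 3 ^ j) $$ (i, i)) = (\<Sum>i<n. A $$ (i, i))" for j
  proof (induction j)
    case 0
    show ?case using A by simp
  next
    case (Suc j)
    then show ?case
      using trace_cube_3[of "A ^\<^sub>m 3 ^ j" n] A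
      by (simp add: pow_mat_mult[OF A, symmetric] pow_carrier_mat mult.commute)
  qed
  have "k \<le> 3 ^ k" using less_exp[of k] power_mono[of 2 3 k] by (simp add: le_trans less_imp_le)
  then have "A ^\<^sub>m 3 ^ k = A ^\<^sub>m k * A ^\<^sub>m (3 ^ k - k)"
    using pow_mat_add[OF A, of k "3 ^ k - k"] by simp
  also have "\<dots> = 0\<^sub>m n n"
    using A by (simp add: nil pow_carrier_mat)
  finally show ?thesis
    using tr[of k] by simp
qed

text \<open>The hypothesis on \<open>e\<close> says that the first two coordinates are injective on the image of \<open>e\<close>, so
  that \<open>e\<close> has rank at most 2. The columns of \<open>e\<close> satisfy linear relations whose coefficients are minors of
  the rows 0 and 1; tracing these relations shows that the trace of \<open>e\<close> is the rank.\<close>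

lemma idempotent_trace_0_imp_0:
  fixes e :: "3 mat"
  assumes e: "e \<in> carrier_mat n n" "e * e = e" and "n \<ge> 2"
    and inj: "\<And>v. v \<in> carrier_vec n \<Longrightarrow> (e *\<^sub>v v) $ 0 = 0 \<Longrightarrow> (e *\<^sub>v v) $ 1 = 0 \<Longrightarrow> e *\<^sub>v v = 0\<^sub>v n"
    and tr: "(\<Sum>i<n. e $$ (i, i)) = 0"
  shows "e = 0\<^sub>m n n"
proof -
  define E where "E i j = e $$ (i, j)" for i j
  have idx: "0 < n" "1 < n" using \<open>n \<ge> 2\<close> by simp_all
  have idem: "(\<Sum>k<n. E i k * E k j) = E i j" if "i < n" "j < n" for i j
    using index_mult_mat_sum[OF e(1) e(1) that] by (simp only: e(2) E_def)
  have inj': "(\<Sum>j<n. E i j * v j) = 0"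
    if 0: "(\<Sum>j<n. E 0 j * v j) = 0" "(\<Sum>j<n. E 1 j * v j) = 0" and i: "i < n" for v i
  proof -
    have ev: "(e *\<^sub>v vec n v) $ i = (\<Sum>j<n. E i j * v j)" if "i < n" for i
      using index_mult_mat_vec_sum[OF e(1) vec_carrier that] by (simp add: E_def)
    have "e *\<^sub>v vec n v = 0\<^sub>v n"
      using 0 by (intro inj) (simp_all only: vec_carrier ev[OF idx(1)] ev[OF idx(2)])
    then show ?thesis
      using ev[OF i] i by simp
  qed
  have pick: "(\<Sum>j<n. f j * (of_bool (j = l) * b)) = f l * b" if "l < n" for f l and b :: 3
    using that by (simp add: of_bool_def if_distrib[of "\<lambda>b. b * _"] if_distrib[of "\<lambda>b. _ * b"] cong: if_cong)
  \<comment> \<open>By injectivity, a relation between columns of \<open>e\<close> that holds in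
    rows 0 and 1 holds in every row.\<close>
  have comb: "E i x * a + E i y * b + E i z * c = 0"
    if xyz: "x < n" "y < n" "z < n" and i: "i < n"
      and 0: "E 0 x * a + E 0 y * b + E 0 z * c = 0" "E 1 x * a + E 1 y * b + E 1 z * c = 0" for i x y z a b c
  proof -
    have "(\<Sum>j<n. E i j * (of_bool (j = x) * a + of_bool (j = y) * b + of_bool (j = z) * c)) =
        E i x * a + E i y * b + E i z * c" for i
      unfolding distrib_left sum.distrib using xyz by (simp only: pick)
    from inj'[of "\<lambda>j. of_bool (j = x) * a + of_bool (j = y) * b + of_bool (j = z) * c", unfolded this, OF 0 i]
    show ?thesis .
  qed
  \<comment> \<open>Cramer's rule relates the columns \<open>x\<close>, \<open>y\<close> and
    \<open>r\<close>, with minors as coefficients. Its entries in row \<open>r\<close>, summed over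
    \<open>r\<close>, yield by idempotency the minor times the trace minus 2; with trace 0 and
    \<open>3 = 0\<close> this is the minor itself.\<close>
  have minor: "E 0 x * E 1 y - E 0 y * E 1 x = 0" (is "?D = 0") if xy: "x < n" "y < n" for x y
  proof -
    have "0 = (\<Sum>r<n. E r x * (E 0 y * E 1 r - E 0 r * E 1 y) + E r y * (E 0 r * E 1 x - E 0 x * E 1 r) + E r r * ?D)"
      using xy by (intro sum.neutral[symmetric] ballI, rule comb) (simp_all add: algebra_simps)
    also have "\<dots> = (\<Sum>r<n. E 0 y * (E 1 r * E r x) - E 1 y * (E 0 r * E r x)
        + (E 1 x * (E 0 r * E r y) - E 0 x * (E 1 r * E r y)) + ?D * E r r)"
      by (intro sum.cong refl) (simp add: algebra_simps)
    also have "\<dots> = E 0 y * E 1 x - E 1 y * E 0 x + (E 1 x * E 0 y - E 0 x * E 1 y) + ?D * (\<Sum>r<n. E r r)"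
      using xy idx by (simp only: sum.distrib sum_subtractf sum_distrib_left[symmetric] idem)
    also have "\<dots> = ?D - 3 * ?D"
      using tr by (simp add: E_def)
    also have "3 * ?D = 0"
      by (rule three_mult)
    finally show ?thesis by simp
  qed
  \<comment> \<open>The same in rank 1: as the minors vanish, columns \<open>x\<close> and
    \<open>r\<close> are related with coefficients from row \<open>i\<close>, and summing yields
    \<open>E i x\<close> times the trace minus 1. The repeated column with coefficient 0 fits this
    to \<open>comb\<close>.\<close>
  have row: "E i x = 0" if i: "i = 0 \<or> i = 1" and x: "x < n" for i x
  proof -
    have "0 = (\<Sum>r<n. E r x * (- E i r) + E r x * 0 + E r r * E i x)"
    proof (intro sum.neutral[symmetric] ballI, rule comb)
      fix r assume "r \<in> {..<n}"
      then show "E 0 x * (- E i r) + E 0 x * 0 + E 0 r * E i x = 0" "E 1 x * (- E i r) + E 1 x * 0 + E 1 r * E i x = 0"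
        using i minor[OF x, of r] by (auto simp: algebra_simps)
    qed (use x in auto)
    also have "\<dots> = (\<Sum>r<n. E i x * E r r - E i r * E r x)"
      by (intro sum.cong refl) (simp add: algebra_simps)
    also have "\<dots> = E i x * (\<Sum>r<n. E r r) - E i x"
      using x i idx by (auto simp only: sum_subtractf sum_distrib_left[symmetric] idem)
    finally show ?thesis
      using tr by (simp add: E_def)
  qed
  have "E i z = 0" if "i < n" "z < n" for i z
    using comb[of z z z i 0 0 1] that row by simp
  then show ?thesis
    using e(1) by (intro eq_matI) (auto simp: E_def)
qed

text \<open>Comparing traces gives \<open>e\<close> the trace 0. A vector in the image of
  \<open>e\<close> whose first two entries are 0 is killed by the diagonal matrix, so
  \<open>q\<close> acts on it as \<open>- s\<close>, and nilpotency makes it 0. Hence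
  \<open>e = 0\<close>, and the diagonal matrix would be nilpotent although it fixes
  \<open>unit_vec n 0\<close>.\<close>

lemma diag_not_decomposable_3:
  fixes q e :: "3 mat"
  assumes q: "q \<in> carrier_mat n n" "q ^\<^sub>m k = 0\<^sub>m n n" and e: "e \<in> carrier_mat n n" "e * e = e"
    and s: "s = 1 \<or> s = -1" and "n \<ge> 2"
    and sum: "mat n n (\<lambda>(i, j). of_bool (i = j \<and> i = 0) - of_bool (i = j \<and> i = 1)) = q + s \<cdot>\<^sub>m e"
  shows False
proof -
  have idx: "0 < n" "1 < n" using \<open>n \<ge> 2\<close> by simp_all
  have ss: "s * s = 1" using s by auto
  have q_eq: "q $$ (i, j) = of_bool (i = j \<and> i = 0) - of_bool (i = j \<and> i = 1) - s * e $$ (i, j)"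
    if "i < n" "j < n" for i j
    using arg_cong[OF sum, of "\<lambda>A. A $$ (i, j)"] that e(1) q(1) by (simp add: algebra_simps)
  have "0 = (\<Sum>i<n. q $$ (i, i))"
    using trace_nilpotent_3[OF q] by simp
  also have "\<dots> = (\<Sum>i<n. of_bool (i = 0) - of_bool (i = 1) - s * e $$ (i, i))"
    by (intro sum.cong refl) (simp add: q_eq)
  also have "\<dots> = - s * (\<Sum>i<n. e $$ (i, i))"
    using idx by (simp add: sum_subtractf sum_negf sum_distrib_left of_bool_def)
  finally have "s * s * (\<Sum>i<n. e $$ (i, i)) = 0"
    by (simp add: mult.assoc)
  then have tr: "(\<Sum>i<n. e $$ (i, i)) = 0"
    by (simp add: ss)
  have qv: "(q *\<^sub>v v) $ i = of_bool (i = 0) * v $ 0 - of_bool (i = 1) * v $ 1 - s * (e *\<^sub>v v) $ i"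
    if v: "v \<in> carrier_vec n" and i: "i < n" for v i
  proof -
    have "(q *\<^sub>v v) $ i = (\<Sum>j<n. of_bool (j = i) * (of_bool (i = 0) * v $ 0 - of_bool (i = 1) * v $ 1) - s * (e $$ (i, j) * v $ j))"
      unfolding index_mult_mat_vec_sum[OF q(1) v i] using i
      by (intro sum.cong) (auto simp: q_eq algebra_simps)
    then show ?thesis
      using i by (simp add: sum_subtractf sum_distrib_left index_mult_mat_vec_sum[OF e(1) v i] of_bool_def
          if_distrib[of "\<lambda>b. b * _"] del: index_mult_mat_vec cong: if_cong)
  qed
  have "e *\<^sub>v v = 0\<^sub>v n"
    if v: "v \<in> carrier_vec n" and 0: "(e *\<^sub>v v) $ 0 = 0" "(e *\<^sub>v v) $ 1 = 0" for v
  proof (rule eq_vecI)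
    have ev: "e *\<^sub>v v \<in> carrier_vec n" using e v by simp
    have eev: "e *\<^sub>v (e *\<^sub>v v) = e *\<^sub>v v"
      using e v by (simp flip: assoc_mult_mat_vec)
    have eig: "q *\<^sub>v (e *\<^sub>v v) = (- s) \<cdot>\<^sub>v (e *\<^sub>v v)"
    proof (rule eq_vecI)
      fix i assume "i < dim_vec ((- s) \<cdot>\<^sub>v (e *\<^sub>v v))"
      then have "i < n" using e(1) by simp
      then show "(q *\<^sub>v (e *\<^sub>v v)) $ i = ((- s) \<cdot>\<^sub>v (e *\<^sub>v v)) $ i"
        using qv[OF ev] 0 ev carrier_matD(1)[OF e(1)] by (simp add: eev del: index_mult_mat_vec)
    qed (use q e in simp_all)
    fix i assume "i < dim_vec (0\<^sub>v n)"
    then have i: "i < n" by simp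
    have "(- s) ^ k * (e *\<^sub>v v) $ i = 0"
      by (rule nilpotent_eigenvector[OF q ev eig i])
    then have "(- s) ^ k * ((- s) ^ k * (e *\<^sub>v v) $ i) = 0"
      by (simp del: index_mult_mat_vec)
    then have "((- s) * (- s)) ^ k * (e *\<^sub>v v) $ i = 0"
      by (simp only: power_mult_distrib mult.assoc)
    then show "(e *\<^sub>v v) $ i = 0\<^sub>v n $ i"
      using i by (simp add: ss del: index_mult_mat_vec)
  qed (use e in simp)
  from idempotent_trace_0_imp_0[OF e \<open>n \<ge> 2\<close> this tr] have "e = 0\<^sub>m n n" .
  moreover have "0\<^sub>m n n *\<^sub>v unit_vec n 0 = (0\<^sub>v n :: 3 vec)"
    by (intro eq_vecI) auto
  ultimately have "q *\<^sub>v unit_vec n 0 = 1 \<cdot>\<^sub>v unit_vec n 0"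
    using qv[of "unit_vec n 0"] idx q(1) by (intro eq_vecI) (auto simp del: index_mult_mat_vec)
  from nilpotent_eigenvector[OF q _ this idx(1)] idx show False
    by simp
qed

lemma GWNC_mat_residue:
  fixes x :: "'a::comm_ring_1"
  assumes G: "GWNC (ring_mat TYPE('a) n ())" and n: "n \<ge> 3" and x: "\<And>k. x ^ k \<noteq> 0"
  obtains \<phi> :: "'a \<Rightarrow> bit" where "comm_ring_hom \<phi>" "\<phi> x = 1"
proof -
  obtain P where P: "is_prime_ideal P" "x \<notin> P"
    using prime_ideal_avoiding[OF x] by blast
  note D = is_prime_idealD[OF P(1)]
  have unipotent: "\<exists>s. (s = 1 \<or> s = -1) \<and> c * (c - s) \<in> P" for c
  proof -
    obtain s k where s: "s = 1 \<or> s = -1" and "(c * (c - s)) ^ k = 0"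
      by (rule GWNC_mat_imp_nilpotent[OF G n])
    then have "(c * (c - s)) ^ k \<in> P" using D(1) by simp
    with s show ?thesis using D(7) by blast
  qed
  \<comment> \<open>Otherwise the residue ring has three elements, and the residue map carries a
    decomposition of \<open>diag(1, -1, 0, ...)\<close> to that field, where none exists.\<close>
  have "2 \<in> P"
  proof (rule ccontr)
    assume "2 \<notin> P"
    have "c * ((c - 1) * (c + 1)) \<in> P" for c
    proof -
      obtain s where s: "s = 1 \<or> s = -1" "c * (c - s) \<in> P" using unipotent by blast
      have "c * ((c - 1) * (c + 1)) = (c + s) * (c * (c - s))"
        using s(1) by (auto simp: algebra_simps)
      then show ?thesis using s(2) D(4) by simp
    qed
    then obtain \<phi> :: "'a \<Rightarrow> 3" where "comm_ring_hom \<phi>"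
      using residue_hom_3[OF P(1) \<open>2 \<notin> P\<close>] by blast
    then interpret \<phi>: comm_ring_hom \<phi> .
    define A :: "'a mat" where
      "A = mat n n (\<lambda>(i, j). of_bool (i = j \<and> i = 0) - of_bool (i = j \<and> i = 1))"
    have A: "A \<in> carrier_mat n n" "2 < n" "\<And>j. j < n \<Longrightarrow> A $$ (2, j) = 0"
      using n by (simp_all add: A_def)
    obtain s q e k where s: "s = 1 \<or> s = -1" and q: "q \<in> carrier_mat n n" "q ^\<^sub>m k = 0\<^sub>m n n"
      and e: "e \<in> carrier_mat n n" "e * e = e" and sum: "A = q + s \<cdot>\<^sub>m e"
      using GWNC_mat_decomposition[OF G A] by metis
    show False
    proof (rule diag_not_decomposable_3)
      show "map_mat \<phi> q \<in> carrier_mat n n" "map_mat \<phi> e \<in> carrier_mat n n" using q e by simp_all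
      show "map_mat \<phi> q ^\<^sub>m k = 0\<^sub>m n n"
        unfolding \<phi>.mat_hom_pow[OF q(1), symmetric] q(2) by (intro eq_matI) auto
      show "map_mat \<phi> e * map_mat \<phi> e = map_mat \<phi> e"
        using \<phi>.mat_hom_mult[OF e(1) e(1)] by (simp add: e(2))
      show "\<phi> s = 1 \<or> \<phi> s = -1" using s by (auto simp: \<phi>.hom_uminus)
      show "n \<ge> 2" using n by simp
      have "map_mat \<phi> A = map_mat \<phi> q + \<phi> s \<cdot>\<^sub>m map_mat \<phi> e"
        using q e by (auto simp: sum \<phi>.hom_add \<phi>.hom_mult intro!: eq_matI)
      moreover have "map_mat \<phi> A = mat n n (\<lambda>(i, j). of_bool (i = j \<and> i = 0) - of_bool (i = j \<and> i = 1))"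
        by (auto simp: A_def \<phi>.hom_minus of_bool_def intro!: eq_matI)
      ultimately show "mat n n (\<lambda>(i, j). of_bool (i = j \<and> i = 0) - of_bool (i = j \<and> i = 1)) =
          map_mat \<phi> q + \<phi> s \<cdot>\<^sub>m map_mat \<phi> e" by simp
    qed
  qed
  \<comment> \<open>Modulo 2 the signs agree: \<open>c * (c + 1)\<close> and
    \<open>c * (c - 1)\<close> differ by \<open>c * 2\<close>.\<close>
  have "c * (c - 1) \<in> P" for c
  proof -
    obtain s where s: "s = 1 \<or> s = -1" "c * (c - s) \<in> P" using unipotent by blast
    have "c * (c - (-1)) - c * 2 = c * (c - 1)" by (simp add: algebra_simps)
    from s(1) show ?thesis
    proof
      assume "s = -1"
      then have "c * (c - (-1)) - c * 2 \<in> P"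
        using s(2) D(4)[OF \<open>2 \<in> P\<close>, of c] by (intro D(5)) simp_all
      then show ?thesis by (simp only: \<open>_ = c * (c - 1)\<close>)
    qed (use s(2) in simp)
  qed
  then obtain \<phi> :: "'a \<Rightarrow> bit" where "comm_ring_hom \<phi>" "\<And>y. y \<notin> P \<Longrightarrow> \<phi> y = 1"
    using residue_hom_bit[OF P(1)] by blast
  then show thesis
    using that P(2) by blast
qed

section \<open>Lifting modulo the nilradical\<close>

text \<open>Newton iteration \<open>y = 3 x^2 - 2 x^3\<close>: the defect \<open>d\<close> becomes
  \<open>d^2 (4 d - 3)\<close>, so the exponent \<open>k \<ge> 2\<close> drops, as
  \<open>2 * (k - 1) \<ge> k\<close>. The ring need not be commutative, but \<open>x\<close>,
  \<open>d\<close>, \<open>u\<close> and \<open>w\<close> commute. The form of \<open>e\<close>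
  shows that homomorphisms killing \<open>d\<close> do not see the correction.\<close>

lemma (in ring) idempotent_lifting:
  assumes "x \<in> carrier R" "(x \<otimes> x \<ominus> x) [^] (k::nat) = \<zero>"
  shows "\<exists>e\<in>carrier R. e \<otimes> e = e \<and> (\<exists>z\<in>carrier R. e = x \<oplus> (x \<otimes> x \<ominus> x) \<otimes> z)"
  using assms
proof (induction k arbitrary: x rule: less_induct)
  case (less k)
  note x = less.prems(1)
  define d where "d = x \<otimes> x \<ominus> x"
  have d: "d \<in> carrier R" using x by (simp add: d_def)
  show ?case
  proof (cases "k \<le> 1")
    case True
    have "d = \<zero>"
    proof (cases "k = 0")
      case True
      then have "\<one> = \<zero>" using less.prems(2) x by simp
      then show ?thesis using d by (metis l_null l_one)
    next
      case False
      then show ?thesis using True less.prems(2) d by (simp add: d_def[symmetric] le_Suc_eq)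
    qed
    moreover have "x \<otimes> x = (x \<otimes> x \<ominus> x) \<oplus> x"
      using x by algebra
    ultimately have "x \<otimes> x = x"
      using x by (simp add: d_def)
    then show ?thesis
      using x by (intro bexI[of _ x] conjI bexI[of _ \<zero>]) simp_all
  next
    case False
    define u where "u = \<one> \<ominus> (x \<oplus> x)"
    define y where "y = x \<oplus> d \<otimes> u"
    define w where "w = d \<oplus> d \<oplus> d \<oplus> d \<ominus> (\<one> \<oplus> \<one> \<oplus> \<one>)"
    have u: "u \<in> carrier R" and y: "y \<in> carrier R" and w: "w \<in> carrier R"
      using x d by (simp_all add: u_def y_def w_def)
    have xd: "x \<otimes> d = d \<otimes> x"
      unfolding d_def using x by (algebra; simp)
    have xu: "x \<otimes> u = u \<otimes> x"
      unfolding u_def using x by (algebra; simp)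
    have du: "u \<otimes> d = d \<otimes> u"
      unfolding u_def using x d xd by (simp add: l_distr r_distr l_minus r_minus a_minus_def minus_add)
    have uu: "u \<otimes> u = \<one> \<oplus> (d \<oplus> d \<oplus> d \<oplus> d)"
      unfolding u_def d_def using x by (algebra; simp)
    have yw: "y \<otimes> y \<ominus> y = (d \<otimes> d) \<otimes> w"
    proof -
      have "y \<otimes> y \<ominus> y = (x \<otimes> x \<ominus> x) \<oplus> (x \<otimes> (d \<otimes> u) \<oplus> (d \<otimes> u) \<otimes> x \<ominus> d \<otimes> u) \<oplus> (d \<otimes> u) \<otimes> (d \<otimes> u)"
        unfolding y_def using x d u by (algebra; simp)
      also have "x \<otimes> (d \<otimes> u) = d \<otimes> (u \<otimes> x)"
        using x d u by (metis m_assoc xd xu)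
      also have "d \<otimes> (u \<otimes> x) \<oplus> (d \<otimes> u) \<otimes> x \<ominus> d \<otimes> u = \<ominus> (d \<otimes> (u \<otimes> (\<one> \<ominus> (x \<oplus> x))))"
        using x d u by (algebra; simp)
      also have "u \<otimes> (\<one> \<ominus> (x \<oplus> x)) = \<one> \<oplus> (d \<oplus> d \<oplus> d \<oplus> d)"
        using uu by (simp add: u_def)
      also have "(d \<otimes> u) \<otimes> (d \<otimes> u) = (d \<otimes> d) \<otimes> (u \<otimes> u)"
        using d u by (metis m_assoc m_closed du)
      also have "u \<otimes> u = \<one> \<oplus> (d \<oplus> d \<oplus> d \<oplus> d)"
        by (rule uu)
      finally have "y \<otimes> y \<ominus> y = d \<oplus> \<ominus> (d \<otimes> (\<one> \<oplus> (d \<oplus> d \<oplus> d \<oplus> d))) \<oplus> (d \<otimes> d) \<otimes> (\<one> \<oplus> (d \<oplus> d \<oplus> d \<oplus> d))"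
        by (simp add: d_def)
      also have "\<dots> = d \<oplus> (\<ominus> d \<oplus> \<ominus> (d \<otimes> d \<oplus> d \<otimes> d \<oplus> d \<otimes> d) \<oplus> \<ominus> (d \<otimes> d)) \<oplus>
          (d \<otimes> d \<oplus> (d \<otimes> d) \<otimes> (d \<oplus> d \<oplus> d \<oplus> d))"
        using d by (simp add: r_distr minus_add a_assoc)
      also have "\<dots> = \<ominus> (d \<otimes> d \<oplus> d \<otimes> d \<oplus> d \<otimes> d) \<oplus> (d \<otimes> d) \<otimes> (d \<oplus> d \<oplus> d \<oplus> d)"
        using d by (simp only: a_assoc r_neg1 r_neg2 a_closed a_inv_closed m_closed)
      also have "\<dots> = (d \<otimes> d) \<otimes> w"
        unfolding w_def using d by (simp add: r_distr a_minus_def r_minus minus_add a_ac)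
      finally show ?thesis .
    qed
    have "(d \<otimes> d) \<otimes> w = w \<otimes> (d \<otimes> d)"
      unfolding w_def using d by (algebra; simp)
    then have "((d \<otimes> d) \<otimes> w) [^] (k - 1) = (d \<otimes> d) [^] (k - 1) \<otimes> w [^] (k - 1)"
      using d w by (intro pow_mult_distrib) simp_all
    also have "(d \<otimes> d) [^] (k - 1) = d [^] (2 * (k - 1))"
      using d nat_pow_pow[of d 2 "k - 1"] by (simp add: numeral_2_eq_2)
    also have "\<dots> = d [^] k \<otimes> d [^] (2 * (k - 1) - k)"
      using d False by (simp add: nat_pow_mult)
    also have "\<dots> = \<zero>"
      using less.prems(2) d by (simp add: d_def[symmetric])
    finally have "(y \<otimes> y \<ominus> y) [^] (k - 1) = \<zero>"
      using w by (simp add: yw)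
    then obtain e z where e: "e \<in> carrier R" "e \<otimes> e = e" "z \<in> carrier R" "e = y \<oplus> (y \<otimes> y \<ominus> y) \<otimes> z"
      using less.IH[of "k - 1" y] y False by auto
    have "e = x \<oplus> d \<otimes> (u \<oplus> d \<otimes> w \<otimes> z)"
      unfolding e(4) yw unfolding y_def using x d u w e(3) by (algebra; simp)
    moreover have "u \<oplus> d \<otimes> w \<otimes> z \<in> carrier R"
      using d u w e(3) by simp
    ultimately show ?thesis
      using e(1,2) unfolding d_def by blast
  qed
qed

text \<open>As \<open>a\<close> is central, each power of \<open>A + a B\<close> differs from that
  of \<open>A\<close> by a multiple of \<open>a\<close>. The \<open>k\<close>-th power is then
  itself such a multiple, and its \<open>l\<close>-th power has the factor
  \<open>a ^ l\<close>.\<close>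

lemma nilpotent_mat_add_smult:
  fixes A B :: "'a::comm_ring_1 mat"
  assumes A: "A \<in> carrier_mat n n" "A ^\<^sub>m k = 0\<^sub>m n n" and B: "B \<in> carrier_mat n n" and a: "a ^ l = 0"
  shows "(A + a \<cdot>\<^sub>m B) ^\<^sub>m (k * l) = 0\<^sub>m n n"
proof -
  have "\<exists>C\<in>carrier_mat n n. (A + a \<cdot>\<^sub>m B) ^\<^sub>m j = A ^\<^sub>m j + a \<cdot>\<^sub>m C" for j
  proof (induction j)
    case 0
    show ?case using A B by (intro bexI[of _ "0\<^sub>m n n"]) (auto intro!: eq_matI)
  next
    case (Suc j)
    then obtain C where C: "C \<in> carrier_mat n n" "(A + a \<cdot>\<^sub>m B) ^\<^sub>m j = A ^\<^sub>m j + a \<cdot>\<^sub>m C" by blast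
    have Aj: "A ^\<^sub>m j \<in> carrier_mat n n" using A(1) by (rule pow_carrier_mat)
    define D where "D = A ^\<^sub>m j * B + C * A + a \<cdot>\<^sub>m (C * B)"
    have D: "D \<in> carrier_mat n n" using Aj A B C(1) by (simp add: D_def)
    have "(A ^\<^sub>m j + a \<cdot>\<^sub>m C) * (A + a \<cdot>\<^sub>m B) = A ^\<^sub>m j * A + a \<cdot>\<^sub>m D"
    proof (rule eq_matI)
      fix r t assume "r < dim_row (A ^\<^sub>m j * A + a \<cdot>\<^sub>m D)" "t < dim_col (A ^\<^sub>m j * A + a \<cdot>\<^sub>m D)"
      then have rt: "r < n" "t < n" using D by simp_all
      then show "((A ^\<^sub>m j + a \<cdot>\<^sub>m C) * (A + a \<cdot>\<^sub>m B)) $$ (r, t) = (A ^\<^sub>m j * A + a \<cdot>\<^sub>m D) $$ (r, t)"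
        using Aj A(1) B C(1) D unfolding D_def
        by (simp add: index_mult_mat_sum[of _ n n _ n] algebra_simps sum.distrib sum_distrib_left
            del: index_mult_mat(1))
    qed (use Aj A B C D in auto)
    then show ?case using C(2) D by auto
  qed
  then obtain C where C: "C \<in> carrier_mat n n" "(A + a \<cdot>\<^sub>m B) ^\<^sub>m k = a \<cdot>\<^sub>m C"
    using A(2) by (metis left_add_zero_mat smult_carrier_mat)
  have "(A + a \<cdot>\<^sub>m B) ^\<^sub>m (k * l) = (a \<cdot>\<^sub>m C) ^\<^sub>m l"
    using pow_mat_mult[of "A + a \<cdot>\<^sub>m B" n k l] A B C(2) by simp
  also have "\<dots> = 0\<^sub>m n n"
    unfolding pow_mat_smult[OF C(1)] a using pow_carrier_mat[OF C(1), of l] carrier_matD[of "C ^\<^sub>m l" n n]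
    by (intro eq_matI) (simp_all del: pow_mat_dim_square pow_mat_dim)
  finally show ?thesis .
qed

text \<open>The entries are switched on one position at a time; each adds a nilpotent multiple of a
  matrix unit, which \<open>nilpotent_mat_add_smult\<close> absorbs.\<close>

lemma nilpotent_entries_imp_nilpotent_mat:
  fixes A :: "'a::comm_ring_1 mat"
  assumes A: "A \<in> carrier_mat n n" and nil: "\<And>i j. i < n \<Longrightarrow> j < n \<Longrightarrow> \<exists>k. A $$ (i, j) ^ k = 0"
  shows "\<exists>k. A ^\<^sub>m k = 0\<^sub>m n n"
proof -
  define restr where "restr X = mat n n (\<lambda>p. of_bool (p \<in> X) * A $$ p)" for X
  have "\<exists>k. restr X ^\<^sub>m k = 0\<^sub>m n n" if "finite X" "X \<subseteq> {..<n} \<times> {..<n}" for X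
    using that
  proof (induction X rule: finite_induct)
    case empty
    have "restr {} ^\<^sub>m 1 = 0\<^sub>m n n"
      by (intro eq_matI) (auto simp: restr_def scalar_prod_def)
    then show ?case by blast
  next
    case (insert p X)
    then obtain k where k: "restr X ^\<^sub>m k = 0\<^sub>m n n" by auto
    obtain l where l: "A $$ p ^ l = 0"
      using insert.prems nil[of "fst p" "snd p"] by auto
    have "restr (insert p X) = restr X + A $$ p \<cdot>\<^sub>m mat n n (\<lambda>p'. of_bool (p' = p))"
      using insert.hyps by (auto simp: restr_def intro!: eq_matI)
    then have "restr (insert p X) ^\<^sub>m (k * l) = 0\<^sub>m n n"
      using nilpotent_mat_add_smult[of "restr X" n k "mat n n (\<lambda>p'. of_bool (p' = p))" "A $$ p" l] k l
      by (simp add: restr_def)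
    then show ?case by blast
  qed
  moreover have "restr ({..<n} \<times> {..<n}) = A"
    using A by (auto simp: restr_def intro!: eq_matI)
  ultimately show ?thesis
    by (metis finite_SigmaI finite_lessThan order_refl)
qed

text \<open>The products expand \<open>1 = (\<Prod>p. a p + (1 - a p))\<close> into elements that are orthogonal idempotents modulo
  the nilradical; at each \<open>\<phi>\<close> exactly one of them takes the value 1.\<close>

lemma bit_hom_interpolation:
  fixes a :: "'i \<Rightarrow> 'a::comm_ring_1" and h :: "'i set \<Rightarrow> bit"
  assumes "finite I"
  obtains r where "\<And>\<phi>::'a \<Rightarrow> bit. comm_ring_hom \<phi> \<Longrightarrow> \<phi> r = h {p \<in> I. \<phi> (a p) = 1}"
proof -
  define w where "w X = (\<Prod>p\<in>I. if p \<in> X then a p else 1 - a p)" for X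
  define r where "r = (\<Sum>X\<in>Pow I. if h X = 1 then w X else 0)"
  have "\<phi> r = h {p \<in> I. \<phi> (a p) = 1}" (is "_ = h ?X") if "comm_ring_hom \<phi>" for \<phi> :: "'a \<Rightarrow> bit"
  proof -
    interpret \<phi>: comm_ring_hom \<phi> by (rule that)
    have w: "\<phi> (w X) = (if X = ?X then 1 else 0)" if "X \<subseteq> I" for X
    proof -
      have "\<phi> (w X) = (\<Prod>p\<in>I. if p \<in> X then \<phi> (a p) else 1 - \<phi> (a p))"
        unfolding w_def \<phi>.hom_prod by (intro prod.cong refl) (simp only: if_distrib[of \<phi>] \<phi>.hom_minus \<phi>.hom_one)
      also have "\<dots> = (\<Prod>p\<in>I. if p \<in> X \<longleftrightarrow> p \<in> ?X then 1 else 0)"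
      proof (intro prod.cong refl)
        fix p assume "p \<in> I"
        then show "(if p \<in> X then \<phi> (a p) else 1 - \<phi> (a p)) = (if p \<in> X \<longleftrightarrow> p \<in> ?X then 1 else 0)"
          by (cases "\<phi> (a p)") simp_all
      qed
      also have "\<dots> = (if \<forall>p\<in>I. p \<in> X \<longleftrightarrow> p \<in> ?X then 1 else 0)"
        using \<open>finite I\<close> by (auto simp: prod_zero_iff)
      also have "(\<forall>p\<in>I. p \<in> X \<longleftrightarrow> p \<in> ?X) \<longleftrightarrow> X = ?X"
        using that by auto
      finally show ?thesis .
    qed
    have "\<phi> r = (\<Sum>X\<in>Pow I. if h X = 1 then \<phi> (w X) else 0)"
      unfolding r_def \<phi>.hom_sum by (intro sum.cong refl) simp
    also have "\<dots> = (\<Sum>X\<in>Pow I. if X = ?X then h ?X else 0)"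
      by (intro sum.cong refl) (auto simp: w)
    also have "\<dots> = h ?X"
      using \<open>finite I\<close> by (subst sum.delta) auto
    finally show ?thesis .
  qed
  then show thesis by (rule that)
qed

text \<open>A homomorphism to \<open>bit\<close> sees \<open>A\<close> only through the set of
  positions it maps to 1, so finitely many decompositions serve all homomorphisms. \<open>F\<close>
  interpolates their idempotents. Elements in all kernels are nilpotent by hypothesis; this applies
  to the entries of \<open>F * F - F\<close> and of a power of \<open>A - G\<close>.\<close>

lemma nil_clean_mat_of_bit_homs:
  fixes A :: "'a::comm_ring_1 mat"
  assumes bit: "\<And>x::'a. (\<And>\<phi>. comm_ring_hom \<phi> \<Longrightarrow> \<phi> x = (0::bit)) \<Longrightarrow> \<exists>k. x ^ k = 0"
    and A: "A \<in> carrier_mat n n"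
  shows "\<exists>E\<in>carrier_mat n n. E * E = E \<and> (\<exists>k. (A - E) ^\<^sub>m k = 0\<^sub>m n n)"
proof -
  have nilpotent: "\<exists>k. M ^\<^sub>m k = 0\<^sub>m n n"
    if M: "M \<in> carrier_mat n n" "\<And>\<phi>::'a \<Rightarrow> bit. comm_ring_hom \<phi> \<Longrightarrow> map_mat \<phi> M = 0\<^sub>m n n" for M
  proof (intro nilpotent_entries_imp_nilpotent_mat[OF M(1)] bit)
    fix i j and \<phi> :: "'a \<Rightarrow> bit" assume ij: "i < n" "j < n" and "comm_ring_hom \<phi>"
    then show "\<phi> (M $$ (i, j)) = 0"
      using arg_cong[OF M(2)[of \<phi>], of "\<lambda>M. M $$ (i, j)"] M(1) by simp
  qed
  define I where "I = {..<n} \<times> {..<n}"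
  define B where "B X = mat n n (\<lambda>p. of_bool (p \<in> X) :: bit)" for X
  have bits: "b = 0 \<or> b = 1" for b :: bit
    by (cases b) simp_all
  have "\<forall>X. \<exists>E. E \<in> carrier_mat n n \<and> E * E = E \<and> (\<exists>k. (B X - E) ^\<^sub>m k = 0\<^sub>m n n)"
  proof
    fix X
    have "B X \<in> carrier_mat n n" by (simp add: B_def)
    from nil_clean_mat_two_elements[OF bits this]
    show "\<exists>E. E \<in> carrier_mat n n \<and> E * E = E \<and> (\<exists>k. (B X - E) ^\<^sub>m k = 0\<^sub>m n n)" by blast
  qed
  then obtain E where E: "\<And>X. E X \<in> carrier_mat n n" "\<And>X. E X * E X = E X"
      "\<And>X. \<exists>k. (B X - E X) ^\<^sub>m k = 0\<^sub>m n n"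
    by metis
  then obtain K where K: "\<And>X. (B X - E X) ^\<^sub>m K X = 0\<^sub>m n n" by metis
  have "\<forall>p. \<exists>r. \<forall>\<phi>::'a \<Rightarrow> bit. comm_ring_hom \<phi> \<longrightarrow> \<phi> r = E {p \<in> I. \<phi> (A $$ p) = 1} $$ p"
  proof
    fix p
    have "finite I" by (simp add: I_def)
    then show "\<exists>r. \<forall>\<phi>::'a \<Rightarrow> bit. comm_ring_hom \<phi> \<longrightarrow> \<phi> r = E {p \<in> I. \<phi> (A $$ p) = 1} $$ p"
      by (rule bit_hom_interpolation[where h = "\<lambda>X. E X $$ p" and a = "\<lambda>p. A $$ p"]) blast
  qed
  then obtain r where r: "\<And>p \<phi>. comm_ring_hom \<phi> \<Longrightarrow> \<phi> (r p) = E {p \<in> I. \<phi> (A $$ p) = 1} $$ p"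
    by metis
  define F where "F = mat n n r"
  have F: "F \<in> carrier_mat n n" by (simp add: F_def)
  have \<phi>F: "map_mat \<phi> F = E {p \<in> I. \<phi> (A $$ p) = 1}" if "comm_ring_hom \<phi>" for \<phi>
    using r[OF that] E(1)[THEN carrier_matD(1)] E(1)[THEN carrier_matD(2)]
    by (intro eq_matI) (simp_all add: F_def)
  have \<phi>A: "map_mat \<phi> A = B {p \<in> I. \<phi> (A $$ p) = 1}" for \<phi> :: "'a \<Rightarrow> bit"
    using A by (auto simp: B_def I_def intro!: eq_matI)
  define D where "D = F * F - F"
  have D: "D \<in> carrier_mat n n" using F by (simp add: D_def minus_carrier_mat)
  have minus_hom: "map_mat \<phi> (M - N) = map_mat \<phi> M - map_mat \<phi> N"
    if "comm_ring_hom \<phi>" "M \<in> carrier_mat n n" "N \<in> carrier_mat n n" for \<phi> :: "'a \<Rightarrow> bit" and M N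
  proof -
    interpret \<phi>: comm_ring_hom \<phi> by (rule that)
    show ?thesis using that(2,3) by (auto simp: \<phi>.hom_minus intro!: eq_matI)
  qed
  have \<phi>D: "map_mat \<phi> D = 0\<^sub>m n n" if "comm_ring_hom \<phi>" for \<phi> :: "'a \<Rightarrow> bit"
  proof -
    interpret \<phi>: comm_ring_hom \<phi> by (rule that)
    show ?thesis
      using F E(1,2) by (simp add: D_def minus_hom[OF that] \<phi>.mat_hom_mult[OF F F] \<phi>F[OF that])
  qed
  obtain k where k: "D ^\<^sub>m k = 0\<^sub>m n n" using nilpotent[OF D \<phi>D] by blast
  interpret M: ring "ring_mat TYPE('a) n ()" by (rule ring_mat)
  have "\<exists>G\<in>carrier (ring_mat TYPE('a) n ()). G \<otimes>\<^bsub>ring_mat TYPE('a) n ()\<^esub> G = G \<and>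
      (\<exists>Z\<in>carrier (ring_mat TYPE('a) n ()). G = F \<oplus>\<^bsub>ring_mat TYPE('a) n ()\<^esub>
        (F \<otimes>\<^bsub>ring_mat TYPE('a) n ()\<^esub> F \<ominus>\<^bsub>ring_mat TYPE('a) n ()\<^esub> F) \<otimes>\<^bsub>ring_mat TYPE('a) n ()\<^esub> Z)"
  proof (rule M.idempotent_lifting)
    show "(F \<otimes>\<^bsub>ring_mat TYPE('a) n ()\<^esub> F \<ominus>\<^bsub>ring_mat TYPE('a) n ()\<^esub> F) [^]\<^bsub>ring_mat TYPE('a) n ()\<^esub> k =
        \<zero>\<^bsub>ring_mat TYPE('a) n ()\<^esub>"
      using F k D by (simp add: ring_mat_simps ring_mat_minus pow_mat_ring_pow[where b = "()", symmetric] flip: D_def)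
  qed (use F in \<open>simp add: ring_mat_simps\<close>)
  then obtain G Z where G: "G \<in> carrier_mat n n" "G * G = G" and Z: "Z \<in> carrier_mat n n" "G = F + D * Z"
    using F by (auto simp: ring_mat_simps ring_mat_minus D_def)
  \<comment> \<open>Lifting leaves the images unchanged, since the correction \<open>D * Z\<close>
    is killed along with \<open>D\<close>.\<close>
  have \<phi>G: "map_mat \<phi> G = E {p \<in> I. \<phi> (A $$ p) = 1}" if "comm_ring_hom \<phi>" for \<phi> :: "'a \<Rightarrow> bit"
  proof -
    interpret \<phi>: comm_ring_hom \<phi> by (rule that)
    have "map_mat \<phi> G = map_mat \<phi> F + map_mat \<phi> (D * Z)"
      using F D Z by (auto simp: \<phi>.hom_add intro!: eq_matI simp del: index_mult_mat(1))
    also have "map_mat \<phi> (D * Z) = 0\<^sub>m n n"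
      using Z(1) by (simp add: \<phi>.mat_hom_mult[OF D Z(1)] \<phi>D[OF that])
    finally show ?thesis using E(1) by (simp add: \<phi>F[OF that])
  qed
  define Q where "Q = A - G"
  have Q: "Q \<in> carrier_mat n n" using G by (simp add: Q_def minus_carrier_mat)
  \<comment> \<open>The sum dominates each \<open>K X\<close>, giving one exponent for all
    homomorphisms.\<close>
  define L where "L = (\<Sum>X\<in>Pow I. K X)"
  have "map_mat \<phi> (Q ^\<^sub>m L) = 0\<^sub>m n n" if "comm_ring_hom \<phi>" for \<phi> :: "'a \<Rightarrow> bit"
  proof -
    interpret \<phi>: comm_ring_hom \<phi> by (rule that)
    define X where "X = {p \<in> I. \<phi> (A $$ p) = 1}"
    have BE: "B X - E X \<in> carrier_mat n n" using E(1) by (simp add: minus_carrier_mat)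
    have "K X \<le> L"
      unfolding L_def by (rule member_le_sum) (auto simp: X_def I_def)
    then have "(B X - E X) ^\<^sub>m L = (B X - E X) ^\<^sub>m K X * (B X - E X) ^\<^sub>m (L - K X)"
      using pow_mat_add[OF BE, of "K X" "L - K X"] by simp
    then have "(B X - E X) ^\<^sub>m L = 0\<^sub>m n n"
      by (simp only: K left_mult_zero_mat[OF pow_carrier_mat[OF BE]])
    moreover have "map_mat \<phi> Q = B X - E X"
      using A G by (simp add: Q_def minus_hom[OF that] \<phi>A \<phi>G[OF that] X_def)
    ultimately show ?thesis
      by (simp add: \<phi>.mat_hom_pow[OF Q])
  qed
  then obtain l where "(Q ^\<^sub>m L) ^\<^sub>m l = 0\<^sub>m n n"
    using nilpotent[OF pow_carrier_mat[OF Q]] by blast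
  then have "Q ^\<^sub>m (L * l) = 0\<^sub>m n n"
    by (simp add: pow_mat_mult[OF Q])
  then show ?thesis
    using G unfolding Q_def by blast
qed

theorem theorem2p37:
  fixes n :: nat
  assumes "n \<ge> 3"
  shows "GWNC (ring_mat TYPE('a::comm_ring_1) n ()) \<longleftrightarrow>
         nil_clean (ring_mat TYPE('a::comm_ring_1) n ())"
proof
  assume G: "GWNC (ring_mat TYPE('a) n ())"
  have bit: "\<exists>k. x ^ k = 0" if "\<And>\<phi>. comm_ring_hom \<phi> \<Longrightarrow> \<phi> x = (0::bit)" for x :: 'a
    using GWNC_mat_residue[OF G assms, of x] that by (metis zero_neq_one)
  show "nil_clean (ring_mat TYPE('a) n ())"
    unfolding nil_clean_def
  proof
    fix A :: "'a mat" assume "A \<in> carrier (ring_mat TYPE('a) n ())"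
    then have A: "A \<in> carrier_mat n n" by (simp add: ring_mat_simps)
    obtain E k where E: "E \<in> carrier_mat n n" "E * E = E" "(A - E) ^\<^sub>m k = 0\<^sub>m n n"
      using nil_clean_mat_of_bit_homs[OF bit A] by blast
    have AE: "A - E \<in> carrier_mat n n" using E(1) by (rule minus_carrier_mat)
    have "A - E \<in> nilpotent_elems (ring_mat TYPE('a) n ())"
      using AE E(3) by (auto simp: nilpotent_elems_def ring_mat_simps pow_mat_ring_pow[where b = "()"])
    moreover have "E \<in> idempotent_elems (ring_mat TYPE('a) n ())"
      using E by (simp add: idempotent_elems_def ring_mat_simps)
    moreover have "A = E + (A - E)"
      using A E(1) by (intro eq_matI) auto
    ultimately show "\<exists>q\<in>nilpotent_elems (ring_mat TYPE('a) n ()). \<exists>e\<in>idempotent_elems (ring_mat TYPE('a) n ()).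
        A = e \<oplus>\<^bsub>ring_mat TYPE('a) n ()\<^esub> q"
      unfolding ring_mat_simps by blast
  qed
next
  interpret ring "ring_mat TYPE('a) n ()" by (rule ring_mat)
  assume "nil_clean (ring_mat TYPE('a) n ())"
  then show "GWNC (ring_mat TYPE('a) n ())"
    unfolding nil_clean_def GWNC_def
    by (metis (no_types, lifting) DiffD1 a_comm idempotent_elems_def mem_Collect_eq nilpotent_elems_def)
qed

end
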